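(* Let $G$ be a discrete non-elementary subgroup of $\mathrm{PU}(2,1)$ such that the invariant trace field $k(G)$ of $G$ is real (i.e. $k(G)\subset\mathbb{R}$). Then $G$ is either $\mathbb{R}$-Fuchsian or $\mathbb{C}$-Fuchsian.
   Context: Let $V=\mathbb{C}^{3}$ with the Hermitian form $\langle z,w\rangle=z_1\bar w_3+z_2\bar w_2+z_3\bar w_1$ of signature $(2,1)$. $\mathrm{SU}(2,1)$ is the group of $3\times 3$ complex matrices of determinant $1$ preserving this form, $\mathrm{PU}(2,1)$ is the corresponding projective unitary group, and $\pi:\mathrm{SU}(2,1)\to\mathrm{PU}(2,1)$ is the natural projection (surjective, with kernel the scalar matrices given by the cube roots of unity). The complex hyperbolic plane $\mathbf{H}^2_{\mathbb{C}}\subset\mathbb{P}(V)$ is the set of projective classes of vectors $v$ with $\langle v,v\rangle<0$, and $\partial\mathbf{H}^2_{\mathbb{C}}$ is the set of classes of nonzero $v$ with $\langle v,v\rangle=0$. A complex geodesic is a nonempty intersection of a complex projective line in $\mathbb{P}(V)$ with $\mathbf{H}^2_{\mathbb{C}}$. A totally real geodesic 2-plane is the image under an element of $\mathrm{PU}(2,1)$ of $\mathbb{P}(\mathbb{R}^3\setminus\{0\})\cap\mathbf{H}^2_{\mathbb{C}}$, where $\mathbb{R}^3\subset V$ is the set of vectors with real coordinates. A subgroup $G$ of $\mathrm{PU}(2,1)$ is elementary if it has a finite orbit in its action on $\mathbf{H}^2_{\mathbb{C}}\cup\partial\mathbf{H}^2_{\mathbb{C}}$, and non-elementary otherwise. $G$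 is $\mathbb{R}$-Fuchsian if it is discrete and leaves invariant a totally real geodesic 2-plane, and $\mathbb{C}$-Fuchsian if it is discrete and leaves invariant a complex geodesic. For a subgroup $\Gamma$ of $\mathrm{SU}(2,1)$, the trace field $\mathbb{Q}(\Gamma)$ is the subfield of $\mathbb{C}$ generated over $\mathbb{Q}$ by the traces of all elements of $\Gamma$. The invariant trace field of $G$ is $k(G)=\mathbb{Q}(\Gamma^{3})$, where $\Gamma=\pi^{-1}(G)$ and $\Gamma^{3}=\langle\gamma^3:\gamma\in\Gamma\rangle$ is the subgroup generated by all cubes. *)

theory Defs
  imports
    "HOL-Analysis.Analysis"
    "HOL-Algebra.Coset"
    "HOL-Algebra.Generated_Groups"
    "HOL-Algebra.Generated_Fields"
    "HOL-Algebra.Algebraic_Closure_Type"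
begin

unbundle no fps_syntax

section \<open>The groups U(2,1), SU(2,1) and PU(2,1)\<close>

definition herm :: "complex^3 \<Rightarrow> complex^3 \<Rightarrow> complex" where
  "herm z w = z $ 1 * cnj (w $ 3) + z $ 2 * cnj (w $ 2) + z $ 3 * cnj (w $ 1)"

definition U21 :: "(complex^3^3) monoid" where
  "U21 = \<lparr>carrier = {A. \<forall>z w. herm (A *v z) (A *v w) = herm z w},
           mult = (**), one = mat 1\<rparr>"

definition SU21 :: "(complex^3^3) monoid" where
  "SU21 = \<lparr>carrier = {A \<in> carrier U21. det A = 1}, mult = (**), one = mat 1\<rparr>"

definition scalars :: "(complex^3^3) set" where
  "scalars = {mat c | c. norm c = 1}"

text \<open>
  Elements of PU(2,1) are cosets, that is, the sets of all unitary lifts of a projective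
  transformation.
\<close>

definition PU21 :: "(complex^3^3) set monoid" where
  "PU21 = U21 Mod scalars"

definition pu_class :: "complex^3^3 \<Rightarrow> (complex^3^3) set" where
  "pu_class A = scalars #>\<^bsub>U21\<^esub> A"

text \<open>The quotient topology induced by the matrix topology on U(2,1).\<close>

definition PU21_topology :: "(complex^3^3) set topology" where
  "PU21_topology = topology (\<lambda>S. S \<subseteq> carrier PU21 \<and>
     openin (top_of_set (carrier U21)) {A \<in> carrier U21. pu_class A \<in> S})"

definition discrete_subgroup :: "(complex^3^3) set set \<Rightarrow> bool" where
  "discrete_subgroup G \<longleftrightarrow>
     subgroup G PU21 \<and> subtopology PU21_topology G = discrete_topology G"

section \<open>The complex hyperbolic plane\<close>

text \<open>
  The class of \<open>v\<close> is the punctured line through \<open>v\<close>; it is a point of the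
  projective plane only for \<open>v \<noteq> 0\<close>.
\<close>

definition proj :: "complex^3 \<Rightarrow> (complex^3) set" where
  "proj v = {c *s v | c. c \<noteq> 0}"

text \<open>The number \<open>herm v v\<close> is always real, see \<open>herm_self_real\<close> below.\<close>

definition H2C :: "(complex^3) set set" where
  "H2C = {proj v | v. Re (herm v v) < 0}"

definition boundary_H2C :: "(complex^3) set set" where
  "boundary_H2C = {proj v | v. v \<noteq> 0 \<and> herm v v = 0}"

definition act :: "(complex^3^3) set \<Rightarrow> (complex^3) set \<Rightarrow> (complex^3) set" where
  "act g p = {A *v v | A v. A \<in> g \<and> v \<in> p}"

definition projective_line :: "(complex^3) set set \<Rightarrow> bool" where
  "projective_line L \<longleftrightarrow>
     (\<exists>W. vec.subspace W \<and> vec.dim W = 2 \<and> L = {proj v | v. v \<in> W \<and> v \<noteq> 0})"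

definition complex_geodesic :: "(complex^3) set set \<Rightarrow> bool" where
  "complex_geodesic C \<longleftrightarrow> C \<noteq> {} \<and> (\<exists>L. projective_line L \<and> C = L \<inter> H2C)"

definition real_points :: "(complex^3) set set" where
  "real_points = {proj v | v. v \<noteq> 0 \<and> (\<forall>i. v $ i \<in> \<real>)}"

definition totally_real_plane :: "(complex^3) set set \<Rightarrow> bool" where
  "totally_real_plane P \<longleftrightarrow> (\<exists>g \<in> carrier PU21. P = act g ` (real_points \<inter> H2C))"

section \<open>Classes of subgroups of PU(2,1)\<close>

definition elementary :: "(complex^3^3) set set \<Rightarrow> bool" where
  "elementary G \<longleftrightarrow> (\<exists>p \<in> H2C \<union> boundary_H2C. finite {act g p | g. g \<in> G})"

definition leaves_invariant :: "(complex^3^3) set set \<Rightarrow> (complex^3) set set \<Rightarrow> bool" where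
  "leaves_invariant G S \<longleftrightarrow> (\<forall>g \<in> G. act g ` S = S)"

definition R_Fuchsian :: "(complex^3^3) set set \<Rightarrow> bool" where
  "R_Fuchsian G \<longleftrightarrow> discrete_subgroup G \<and> (\<exists>P. totally_real_plane P \<and> leaves_invariant G P)"

definition C_Fuchsian :: "(complex^3^3) set set \<Rightarrow> bool" where
  "C_Fuchsian G \<longleftrightarrow> discrete_subgroup G \<and> (\<exists>C. complex_geodesic C \<and> leaves_invariant G C)"

section \<open>Trace fields\<close>

text \<open>
  Any subfield of the complex numbers contains the rationals, so the field generated by a set
  is the field generated by it over the rationals.
\<close>

definition trace_field :: "(complex^3^3) set \<Rightarrow> complex set" where
  "trace_field \<Gamma> = generate_field (ring_of_type_algebra :: complex ring) (trace ` \<Gamma>)"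

definition SU21_preimage :: "(complex^3^3) set set \<Rightarrow> (complex^3^3) set" where
  "SU21_preimage G = {A \<in> carrier SU21. pu_class A \<in> G}"

definition cube_subgroup :: "(complex^3^3) set \<Rightarrow> (complex^3^3) set" where
  "cube_subgroup \<Gamma> = generate SU21 {A [^]\<^bsub>SU21\<^esub> (3::nat) | A. A \<in> \<Gamma>}"

definition invariant_trace_field :: "(complex^3^3) set set \<Rightarrow> complex set" where
  "invariant_trace_field G = trace_field (cube_subgroup (SU21_preimage G))"

section \<open>Well-definedness of the definitions\<close>

lemma herm_self_real: "herm v v \<in> \<real>"
proof -
  have "cnj (herm v v) = herm v v"
    by (simp add: herm_def algebra_simps)
  thus ?thesis by (metis Reals_cnj_iff)
qed

lemma herm_nondegenerate:
  assumes "\<And>w. herm v w = 0"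
  shows "v = 0"
proof -
  have "v $ 1 = 0" using assms[of "axis 3 1"] by (simp add: herm_def axis_def)
  moreover have "v $ 2 = 0" using assms[of "axis 2 1"] by (simp add: herm_def axis_def)
  moreover have "v $ 3 = 0" using assms[of "axis 1 1"] by (simp add: herm_def axis_def)
  ultimately show ?thesis by (simp add: vec_eq_iff forall_3)
qed

lemma U21_inverse:
  assumes "A \<in> carrier U21"
  shows "\<exists>B \<in> carrier U21. B ** A = mat 1 \<and> A ** B = mat 1"
proof -
  have A: "herm (A *v z) (A *v w) = herm z w" for z w
    using assms by (simp add: U21_def)
  have "v = 0" if "A *v v = 0" for v
    by (rule herm_nondegenerate) (use A[of v] that in \<open>simp add: herm_def\<close>)
  then obtain B where BA: "B ** A = mat 1"
    using matrix_left_invertible_ker[of A] by blast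
  hence AB: "A ** B = mat 1" by (simp add: matrix_left_right_inverse)
  have "herm (B *v z) (B *v w) = herm z w" for z w
    using A[of "B *v z" "B *v w"] AB by (simp add: matrix_vector_mul_assoc)
  thus ?thesis using BA AB by (auto simp: U21_def)
qed

lemma group_U21: "group U21"
proof (rule groupI)
  fix A assume "A \<in> carrier U21"
  thus "\<exists>B \<in> carrier U21. B \<otimes>\<^bsub>U21\<^esub> A = \<one>\<^bsub>U21\<^esub>"
    using U21_inverse[of A] by (auto simp: U21_def)
qed (auto simp: U21_def matrix_mul_assoc simp flip: matrix_vector_mul_assoc)

lemma subgroup_SU21: "subgroup (carrier SU21) U21"
proof (rule group.subgroupI[OF group_U21])
  fix A assume A: "A \<in> carrier SU21"
  hence AU: "A \<in> carrier U21" and d: "det A = 1" by (auto simp: SU21_def)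
  have "inv\<^bsub>U21\<^esub> A ** A = mat 1"
    using group.l_inv[OF group_U21 AU] by (simp add: U21_def)
  hence "det (inv\<^bsub>U21\<^esub> A) * det A = 1" by (metis det_I det_mul)
  thus "inv\<^bsub>U21\<^esub> A \<in> carrier SU21"
    using d group.inv_closed[OF group_U21 AU] by (simp add: SU21_def)
next
  fix A B assume "A \<in> carrier SU21" "B \<in> carrier SU21"
  thus "A \<otimes>\<^bsub>U21\<^esub> B \<in> carrier SU21"
    by (auto simp: SU21_def U21_def det_mul simp flip: matrix_vector_mul_assoc)
next
  show "carrier SU21 \<noteq> {}"
    by (auto simp: SU21_def U21_def intro!: exI[of _ "mat 1"])
qed (auto simp: SU21_def)

lemma group_SU21: "group SU21"
  using group.subgroup_imp_group[OF group_U21 subgroup_SU21]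
  by (simp add: SU21_def U21_def)

lemma mat_vector_mult: "mat c *v (v :: complex^'n) = c *s v"
  by (simp add: vec_eq_iff matrix_vector_mult_def mat_def if_distrib if_distribR cong: if_cong)

lemma mat_mult_mat: "mat c ** (mat d :: complex^'n^'n) = mat (c * d)"
  by (rule matrix_eq[THEN iffD2])
    (simp add: mat_vector_mult flip: matrix_vector_mul_assoc)

lemma mat_commutes: "mat c ** (A :: complex^'n^'n) = A ** mat c"
  by (rule matrix_eq[THEN iffD2])
    (simp add: mat_vector_mult vec.scale flip: matrix_vector_mul_assoc)

lemma herm_scale: "herm (c *s z) (d *s w) = c * cnj d * herm z w"
  by (simp add: herm_def algebra_simps)

lemma scalars_subset: "scalars \<subseteq> carrier U21"
  by (auto simp: scalars_def U21_def mat_vector_mult herm_scale complex_norm_square[symmetric])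

lemma normal_scalars: "scalars \<lhd> U21"
proof -
  have "subgroup scalars U21"
  proof (rule group.subgroupI[OF group_U21])
    fix A assume "A \<in> scalars"
    then obtain c where c: "A = mat c" "norm c = 1" by (auto simp: scalars_def)
    hence "c \<noteq> 0" by auto
    have "mat (inverse c) \<in> scalars" using c by (auto simp: scalars_def norm_inverse)
    moreover have "inv\<^bsub>U21\<^esub> A = mat (inverse c)"
      by (rule group.inv_equality[OF group_U21])
        (use c \<open>c \<noteq> 0\<close> \<open>A \<in> scalars\<close> scalars_subset calculation in
          \<open>auto simp: U21_def mat_mult_mat\<close>)
    ultimately show "inv\<^bsub>U21\<^esub> A \<in> scalars" by simp
  next
    fix A B assume "A \<in> scalars" "B \<in> scalars"
    thus "A \<otimes>\<^bsub>U21\<^esub> B \<in> scalars"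
      by (auto simp: scalars_def U21_def mat_mult_mat norm_mult)
  next
    show "scalars \<noteq> {}" by (auto simp: scalars_def intro!: exI[of _ 1])
  qed (rule scalars_subset)
  moreover have "scalars #>\<^bsub>U21\<^esub> A = A <#\<^bsub>U21\<^esub> scalars" for A
    by (auto simp: r_coset_def l_coset_def U21_def scalars_def mat_commutes)
  ultimately show ?thesis
    by (simp add: normal_def normal_axioms_def group_U21)
qed

lemma group_PU21: "group PU21"
  unfolding PU21_def by (rule normal.factorgroup_is_group[OF normal_scalars])

lemma carrier_PU21: "carrier PU21 = pu_class ` carrier U21"
  by (simp add: PU21_def pu_class_def carrier_FactGroup)

lemma openin_PU21_topology:
  "openin PU21_topology S \<longleftrightarrow> S \<subseteq> carrier PU21 \<and>
     openin (top_of_set (carrier U21)) {A \<in> carrier U21. pu_class A \<in> S}"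
proof -
  let ?pre = "\<lambda>S. {A \<in> carrier U21. pu_class A \<in> S}"
  let ?T = "\<lambda>S. S \<subseteq> carrier PU21 \<and> openin (top_of_set (carrier U21)) (?pre S)"
  have "istopology ?T"
    unfolding istopology_def
  proof (intro conjI allI impI)
    fix S T assume "?T S" "?T T"
    moreover have "?pre (S \<inter> T) = ?pre S \<inter> ?pre T" by auto
    ultimately show "S \<inter> T \<subseteq> carrier PU21"
      "openin (top_of_set (carrier U21)) (?pre (S \<inter> T))"
      by (auto intro: openin_Int)
  next
    fix K assume K: "\<forall>S\<in>K. ?T S"
    have "?pre (\<Union> K) = \<Union> (?pre ` K)" by auto
    with K show "\<Union> K \<subseteq> carrier PU21" "openin (top_of_set (carrier U21)) (?pre (\<Union> K))"
      by (auto intro!: openin_Union)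
  qed
  thus ?thesis by (simp add: PU21_topology_def topology_inverse')
qed

lemma quotient_map_pu_class: "quotient_map (top_of_set (carrier U21)) PU21_topology pu_class"
proof -
  have "openin (top_of_set (carrier U21)) {A \<in> carrier U21. pu_class A \<in> carrier PU21}"
  proof -
    have "{A \<in> carrier U21. pu_class A \<in> carrier PU21} = carrier U21"
      by (auto simp: carrier_PU21)
    thus ?thesis by simp
  qed
  hence "openin PU21_topology (carrier PU21)"
    by (simp add: openin_PU21_topology)
  hence "topspace PU21_topology = carrier PU21"
    by (metis openin_PU21_topology openin_subset openin_topspace subset_antisym)
  thus ?thesis
    by (auto simp: quotient_map_def carrier_PU21 openin_PU21_topology)
qed

lemma act_pu_class: "act (pu_class A) (proj v) = proj (A *v v)"
proof -
  have "act (pu_class A) (proj v) = {(c * d) *s (A *v v) | c d. norm c = 1 \<and> d \<noteq> 0}"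
  proof -
    have coset: "pu_class A = {mat c ** A | c. norm c = 1}"
      by (auto simp: pu_class_def r_coset_def scalars_def U21_def)
    have step: "(mat c ** A) *v (d *s v) = (c * d) *s (A *v v)" for c d
      by (simp add: mat_vector_mult vec.scale flip: matrix_vector_mul_assoc)
    have "act (pu_class A) (proj v) = {(mat c ** A) *v (d *s v) | c d. norm c = 1 \<and> d \<noteq> 0}"
      unfolding act_def coset proj_def by blast
    thus ?thesis by (simp only: step)
  qed
  also have "\<dots> = proj (A *v v)"
  proof (intro equalityI subsetI)
    fix x assume "x \<in> {(c * d) *s (A *v v) | c d. norm c = 1 \<and> d \<noteq> 0}"
    then obtain c d where "x = (c * d) *s (A *v v)" "norm c = 1" "d \<noteq> 0" by blast
    moreover from this have "c * d \<noteq> 0" by auto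
    ultimately show "x \<in> proj (A *v v)" unfolding proj_def by blast
  next
    fix x assume "x \<in> proj (A *v v)"
    then obtain d where "x = d *s (A *v v)" "d \<noteq> 0" by (auto simp: proj_def)
    hence "x = (1 * d) *s (A *v v) \<and> norm (1::complex) = 1 \<and> d \<noteq> 0" by simp
    thus "x \<in> {(c * d) *s (A *v v) | c d. norm c = 1 \<and> d \<noteq> 0}" by blast
  qed
  finally show ?thesis .
qed

end

theory Submission
  imports Defs
begin

no_notation fps_nth (infixl \<open>$\<close> 75)

text \<open>
  Let \<open>\<Gamma>\<close> be the preimage of \<open>G\<close> in SU(2,1) and \<open>N = \<Gamma>\<^sup>3\<close>, a normal subgroup with real traces.
  If \<open>\<Gamma>\<close> is reducible, then it has an invariant line; this line is positive since \<open>G\<close> is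
  non-elementary, and its orthogonal complement is an invariant complex geodesic. If \<open>\<Gamma>\<close> is
  irreducible but \<open>N\<close> is not, Clifford theory shows that \<open>N\<close> acts by scalars, hence trivially as
  its traces are real; then \<open>\<Gamma>\<close> has exponent 3, so only finitely many traces, and is finite. If
  \<open>N\<close> is irreducible, it spans the full matrix algebra by Burnside's theorem, and its real span
  is a real form of this algebra. The corresponding complex conjugation of matrices is induced by
  an antilinear map \<open>j\<close> of the space commuting with \<open>N\<close>. Determinants exclude the quaternionic
  case, since the dimension is odd, and show that \<open>j\<close> conjugates the Hermitian form. By Schur's
  lemma \<open>\<Gamma>\<close> permutes the fixed lines of \<open>j\<close>, which form a totally real plane.
\<close>

section \<open>The Hermitian form and Cayley-Hamilton\<close>

text \<open>The lifts of one projective transformation to SU(2,1) differ by cube roots of unity, and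
  passing to cubes removes this ambiguity. The obstacle is that real traces are given only for
  \<open>N\<close>, while an invariant set is wanted for \<Gamma>. Schur's lemma for
  \<open>N\<close> is the bridge. It is applied to three linear maps: to \<open>j\<close> composed
  with itself, to the map comparing the Hermitian form with its transform under \<open>j\<close>,
  and to the comparison of \<open>j\<close> with its conjugate under an element of \<Gamma>. Each
  application leaves an unknown scalar. The first is positive because its cube is the squared
  modulus of a determinant, and rescaling \<open>j\<close> makes it 1. The second is a real cube
  root of 1. The third has modulus 1 but need not be 1, as the scalar matrices in \<Gamma> already
  show; hence \<Gamma> permutes the lines fixed by \<open>j\<close>, not the fixed vectors. The
  vector (1, 0, -1), of norm -2, is the negative vector used throughout.\<close>

lemma herm_add_left: "herm (a + b) w = herm a w + herm b w"
  by (simp add: herm_def algebra_simps)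

lemma herm_add_right: "herm z (a + b) = herm z a + herm z b"
  by (simp add: herm_def algebra_simps)

lemma herm_diff_left: "herm (a - b) w = herm a w - herm b w"
  by (simp add: herm_def algebra_simps)

lemma herm_diff_right: "herm z (a - b) = herm z a - herm z b"
  by (simp add: herm_def algebra_simps)

lemma herm_scale_left: "herm (c *s z) w = c * herm z w"
  by (simp add: herm_def algebra_simps)

lemma herm_scale_right: "herm z (c *s w) = cnj c * herm z w"
  by (simp add: herm_def algebra_simps)

lemma herm_0 [simp]: "herm 0 w = 0" "herm z 0 = 0"
  by (simp_all add: herm_def)

lemma herm_cnj: "cnj (herm z w) = herm w z"
  by (simp add: herm_def algebra_simps)

lemmas herm_simps = herm_add_left herm_add_right herm_diff_left herm_diff_right
  herm_scale_left herm_scale_right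

lemma herm_self_Re: "herm v v = of_real (Re (herm v v))"
  using herm_self_real[of v] by simp

lemma herm_eq0_sym: "herm z w = 0 \<longleftrightarrow> herm w z = 0"
  by (metis herm_cnj complex_cnj_zero)

lemma herm_axis:
  "herm v (axis 1 1) = v $ 3" "herm v (axis 2 1) = v $ 2" "herm v (axis 3 1) = v $ 1"
  by (simp_all add: herm_def axis_def)

lemma herm_right_eqI:
  assumes "\<And>w. herm u w = herm v w"
  shows "u = v"
  using herm_nondegenerate[of "u - v"] assms by (simp add: herm_diff_left)

lemma U21_herm: "A \<in> carrier U21 \<Longrightarrow> herm (A *v z) (A *v w) = herm z w"
  by (simp add: U21_def)

lemma SU21_in_U21: "A \<in> carrier SU21 \<Longrightarrow> A \<in> carrier U21"
  by (simp add: SU21_def)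

text \<open>The hypothesis is a matrix identity between the Gram matrix \<open>F\<close> and its
  transform, and \<open>det F\<close> is -1, so determinants can be compared. It is used with scalar
  1 for unitary lifts and with an unknown scalar for the linear part of \<open>j\<close>.\<close>

lemma det_of_form_scaling:
  fixes A :: "complex^3^3"
  assumes "\<And>z w. herm (A *v z) (A *v w) = \<mu> * herm z w"
  shows "det A * cnj (det A) = \<mu> ^ 3"
proof -
  define F :: "complex^3^3" where "F = (\<chi> i k. herm (axis i 1) (axis k 1))"
  define B :: "complex^3^3" where "B = (\<chi> i k. cnj (A $ i $ k))"
  have "transpose A ** F ** B = mat \<mu> ** F"
  proof -
    have "A *v axis i 1 = (\<chi> l. A $ l $ i)" for i
      unfolding vec_eq_iff by (simp add: matrix_vector_mult_def axis_def if_distrib cong: if_cong)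
    hence "(transpose A ** F ** B) $ i $ k = herm (A *v axis i 1) (A *v axis k 1)" for i k
      by (simp add: matrix_matrix_mult_def transpose_def F_def B_def herm_def axis_def sum_3)
    moreover have "(mat \<mu> ** F) $ i $ k = \<mu> * herm (axis i 1) (axis k 1)" for i k
      by (simp add: matrix_matrix_mult_def mat_def F_def if_distrib if_distribR cong: if_cong)
    ultimately show ?thesis using assms by (simp add: vec_eq_iff)
  qed
  hence "det A * det F * det B = det (mat \<mu> :: complex^3^3) * det F"
    by (metis det_mul det_transpose)
  moreover have "det F = -1"
    by (simp add: det_3 F_def herm_def axis_def)
  moreover have "det B = cnj (det A)"
    by (simp add: det_3 B_def)
  moreover have "det (mat \<mu> :: complex^3^3) = \<mu> ^ 3"
    by (simp add: det_3 mat_def power3_eq_cube)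
  ultimately show ?thesis by simp
qed

text \<open>By Newton's identities \<open>e\<close> is the second elementary symmetric function of
  the eigenvalues. Written with traces, the equation yields relations among traces once it is
  multiplied by a power of \<open>A\<close> and traced.\<close>

lemma cayley_hamilton_3:
  fixes A :: "complex^3^3"
  defines "e \<equiv> ((trace A)\<^sup>2 - trace (A ** A)) / 2"
  shows "A ** A ** A + mat e ** A = mat (trace A) ** (A ** A) + mat (det A)"
proof -
  have e: "e = A$1$1 * A$2$2 + A$1$1 * A$3$3 + A$2$2 * A$3$3
      - A$1$2 * A$2$1 - A$1$3 * A$3$1 - A$2$3 * A$3$2"
    by (simp add: e_def trace_def matrix_matrix_mult_def sum_3 power2_eq_square field_simps)
  show ?thesis
    unfolding vec_eq_iff forall_3 e trace_def det_3
    by (simp add: matrix_matrix_mult_def mat_def sum_3 algebra_simps)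
qed

section \<open>Burnside's theorem for unitary groups\<close>

lemma cubic_roots:
  fixes a b c :: complex
  obtains x y z where "a = x + y + z" "b = x * y + x * z + y * z" "c = x * y * z"
proof -
  have "\<not> constant (poly [:- c, b, - a, 1:])"
    by (simp add: constant_degree)
  then obtain x where x: "poly [:- c, b, - a, 1:] x = 0"
    using fundamental_theorem_of_algebra by blast
  define s q where "s = a - x" and "q = b - x * s"
  define r where "r = csqrt (s\<^sup>2 - 4 * q)"
  have r: "r\<^sup>2 = s\<^sup>2 - 4 * q" by (simp add: r_def)
  define y z where "y = (s + r) / 2" and "z = (s - r) / 2"
  have yz: "y + z = s" "y * z = q"
    using r by (simp_all add: y_def z_def field_simps power2_eq_square)
  have "c = x * q"
    using x by (simp add: q_def s_def algebra_simps)
  hence "c = x * y * z" using yz by (simp add: mult.assoc)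
  moreover have "a = x + y + z" using yz by (simp add: s_def algebra_simps)
  moreover have "b = x * y + x * z + y * z"
  proof -
    have "b = y * z + x * (y + z)" by (simp add: yz q_def)
    thus ?thesis by (simp add: algebra_simps)
  qed
  ultimately show thesis using that by blast
qed

text \<open>The characteristic polynomial splits as (B - p)(B - q)(B - r) and annihilates
  \<open>w\<close>. Apply the factors to \<open>w\<close> one after the other, staying in
  \<open>W\<close>: the last nonzero vector among \<open>w\<close>, \<open>x\<close>,
  \<open>y\<close> is an eigenvector. No basis of \<open>W\<close> is needed.\<close>

lemma eigenvector_in_invariant_subspace:
  fixes B :: "complex^3^3"
  assumes W: "vec.subspace W" "\<And>v. v \<in> W \<Longrightarrow> B *v v \<in> W"
    and w: "w \<in> W" "w \<noteq> 0"
  obtains x l where "x \<in> W" "x \<noteq> 0" "B *v x = l *s x"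
proof -
  obtain e where e: "B ** B ** B + mat e ** B = mat (trace B) ** (B ** B) + mat (det B)"
    using cayley_hamilton_3 by blast
  obtain p q r where pqr: "trace B = p + q + r" "e = p * q + p * r + q * r" "det B = p * q * r"
    by (rule cubic_roots)
  have shift: "B *v v - c *s v \<in> W" if "v \<in> W" for c v
    using W that by (simp add: vec.subspace_diff vec.subspace_scale)
  define x where "x = B *v w - p *s w"
  define y where "y = B *v x - q *s x"
  have "(B ** B ** B + mat e ** B) *v w = (mat (trace B) ** (B ** B) + mat (det B)) *v w"
    using e by simp
  hence "B *v (B *v (B *v w)) + e *s (B *v w) = trace B *s (B *v (B *v w)) + det B *s w"
    by (simp add: matrix_vector_mult_add_rdistrib mat_vector_mult flip: matrix_vector_mul_assoc)
  hence "B *v y - r *s y = 0"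
    unfolding pqr x_def y_def
    by (simp add: vec.scale algebra_simps)
  hence "B *v y = r *s y" by simp
  moreover have "x \<in> W"
    unfolding x_def by (rule shift) (rule w)
  moreover from this have "y \<in> W"
    unfolding y_def by (rule shift)
  ultimately show thesis
    using that w x_def y_def by (metis eq_iff_diff_eq_0)
qed

text \<open>The complex linear span, with scalars entering as scalar matrices. On this type
  \<open>span\<close> is the real span, which later provides the real form.\<close>

inductive_set cspan :: "(complex^3^3) set \<Rightarrow> (complex^3^3) set" for S where
  cspan_base: "M \<in> S \<Longrightarrow> M \<in> cspan S"
| cspan_add: "M \<in> cspan S \<Longrightarrow> Y \<in> cspan S \<Longrightarrow> M + Y \<in> cspan S"
| cspan_scale: "M \<in> cspan S \<Longrightarrow> mat c ** M \<in> cspan S"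

definition acts_irreducibly :: "(complex^3^3) set \<Rightarrow> bool" where
  "acts_irreducibly S \<longleftrightarrow>
     (\<forall>W. vec.subspace W \<and> (\<forall>A\<in>S. \<forall>v\<in>W. A *v v \<in> W) \<longrightarrow> W = {0} \<or> W = UNIV)"

lemma acts_irreduciblyD:
  assumes "acts_irreducibly S" "vec.subspace W" "\<And>A v. A \<in> S \<Longrightarrow> v \<in> W \<Longrightarrow> A *v v \<in> W"
    and "w \<in> W" "w \<noteq> 0"
  shows "W = UNIV"
  using assms(1)[unfolded acts_irreducibly_def, rule_format, of W] assms(2-) by fast

text \<open>The operator sending \<open>v\<close> to \<open>herm v g *s z\<close>. Every linear
  functional is \<open>herm _ g\<close> for some \<open>g\<close>; this parametrization lets
  unitarity turn right multiplication by an inverse into an action on \<open>g\<close>.\<close>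

definition rank_one :: "complex^3 \<Rightarrow> complex^3 \<Rightarrow> complex^3^3" where
  "rank_one z g = (\<chi> i k. herm (axis k 1) g * z $ i)"

lemma rank_one_apply: "rank_one z g *v v = herm v g *s z"
  unfolding vec_eq_iff
  by (simp add: rank_one_def matrix_vector_mult_def herm_def axis_def sum_3 algebra_simps)

lemma matrix_eqI: "(\<And>v. A *v v = B *v v) \<Longrightarrow> A = B" for A B :: "complex^3^3"
  using matrix_eq by blast

text \<open>Under the form the standard basis is dual to itself in reverse order, whence the pairing
  of indices 1 and 3.\<close>

lemma matrix_as_rank_ones:
  fixes M :: "complex^3^3"
  shows "M = rank_one (M *v axis 1 1) (axis 3 1) + rank_one (M *v axis 2 1) (axis 2 1)
    + rank_one (M *v axis 3 1) (axis 1 1)"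
proof (rule matrix_eqI)
  fix v :: "complex^3"
  have "v = v $ 1 *s axis 1 1 + v $ 2 *s axis 2 1 + v $ 3 *s axis 3 1"
    by (simp add: vec_eq_iff forall_3 axis_def)
  from arg_cong[OF this, of "(*v) M"]
  have "M *v v = v $ 1 *s (M *v axis 1 1) + v $ 2 *s (M *v axis 2 1) + v $ 3 *s (M *v axis 3 1)"
    by (simp only: matrix_vector_right_distrib vec.scale)
  thus "M *v v = (rank_one (M *v axis 1 1) (axis 3 1) + rank_one (M *v axis 2 1) (axis 2 1)
    + rank_one (M *v axis 3 1) (axis 1 1)) *v v"
    by (simp add: matrix_vector_mult_add_rdistrib rank_one_apply herm_axis)
qed

lemma matrix_add_rdistrib: "(A + B) ** C = A ** C + B ** C" for A B C :: "complex^3^3"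
  by (rule matrix_eqI) (simp add: matrix_vector_mult_add_rdistrib flip: matrix_vector_mul_assoc)

locale unitary_group =
  fixes S :: "(complex^3^3) set"
  assumes unitary: "S \<subseteq> carrier U21"
    and one: "mat 1 \<in> S"
    and mult: "A \<in> S \<Longrightarrow> B \<in> S \<Longrightarrow> A ** B \<in> S"
    and inverse: "A \<in> S \<Longrightarrow> \<exists>B\<in>S. A ** B = mat 1 \<and> B ** A = mat 1"
begin

lemma herm_invariant: "A \<in> S \<Longrightarrow> herm (A *v z) (A *v w) = herm z w"
  using unitary U21_herm by blast

lemma cspan_mult:
  assumes "M \<in> cspan S" "Y \<in> cspan S"
  shows "M ** Y \<in> cspan S"
proof -
  have "A ** Y \<in> cspan S" if "A \<in> S" for A
    using assms(2)
  proof induction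
    case (cspan_scale Y c)
    have "A ** (mat c ** Y) = mat c ** (A ** Y)"
      by (simp only: matrix_mul_assoc mat_commutes[of c A])
    thus ?case using cspan_scale by (simp add: cspan.cspan_scale)
  qed (auto intro: cspan.intros mult that simp: matrix_add_ldistrib)
  with assms(1) show ?thesis
    by induction
      (auto intro: cspan.intros simp: matrix_add_rdistrib simp flip: matrix_mul_assoc)
qed

lemma cspan_one: "mat c \<in> cspan S"
  using cspan_scale[OF cspan_base[OF one], of c] by simp

text \<open>The images of \<open>v\<close> under the algebra form an \<open>S\<close>-invariant
  subspace that contains \<open>v\<close>.\<close>

lemma cspan_transitive:
  assumes "acts_irreducibly S" "v \<noteq> 0"
  obtains M where "M \<in> cspan S" "M *v v = w"
proof -
  let ?W = "{M *v v | M. M \<in> cspan S}"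
  have "vec.subspace ?W"
    unfolding vec.subspace_def
  proof (intro conjI allI impI ballI)
    show "0 \<in> ?W" using cspan_one[of 0] by (auto intro!: exI[of _ 0])
  next
    fix x y assume "x \<in> ?W" "y \<in> ?W"
    then obtain M Y where "M \<in> cspan S" "Y \<in> cspan S" "x = M *v v" "y = Y *v v" by blast
    hence "M + Y \<in> cspan S" "x + y = (M + Y) *v v"
      by (simp_all add: cspan_add matrix_vector_mult_add_rdistrib)
    thus "x + y \<in> ?W" by blast
  next
    fix c x assume "x \<in> ?W"
    then obtain M where "M \<in> cspan S" "x = M *v v" by blast
    hence "mat c ** M \<in> cspan S" "c *s x = (mat c ** M) *v v"
      by (simp_all add: cspan_scale mat_vector_mult flip: matrix_vector_mul_assoc)
    thus "c *s x \<in> ?W" by blast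
  qed
  moreover have "A *v w \<in> ?W" if A: "A \<in> S" and "w \<in> ?W" for A w
  proof -
    from that obtain M where "M \<in> cspan S" "w = M *v v" by blast
    hence "A ** M \<in> cspan S" "A *v w = (A ** M) *v v"
      using A by (auto intro: cspan_mult cspan_base simp: matrix_vector_mul_assoc)
    thus ?thesis by blast
  qed
  moreover have "v \<in> ?W"
    using cspan_one[of 1] by (auto intro!: exI[of _ "mat 1"])
  ultimately have "?W = UNIV"
    by (rule acts_irreduciblyD[OF assms(1) _ _ _ assms(2)])
  hence "w \<in> ?W" by (simp only: UNIV_I)
  thus thesis using that by blast
qed

text \<open>
  In an irreducible matrix algebra a nonzero element with the largest possible kernel has
  rank one: otherwise some product \<open>T A\<close> has an eigenvector \<open>T x\<close> and
  \<open>(T A - l) T\<close> is a nonzero element with a larger kernel.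
\<close>

lemma cspan_rank_one:
  assumes irr: "acts_irreducibly S"
  obtains u g where "u \<noteq> 0" "g \<noteq> 0" "rank_one u g \<in> cspan S"
proof -
  define ker where "ker T = {v. T *v v = 0}" for T :: "complex^3^3"
  have subspace_ker: "vec.subspace (ker T)" for T
    by (auto simp: vec.subspace_def ker_def matrix_vector_right_distrib vec.scale)
  define P where "P T \<longleftrightarrow> T \<in> cspan S \<and> T \<noteq> 0" for T :: "complex^3^3"
  have bound: "vec.dim (ker T) \<le> 3" for T
    using dim_subset_UNIV_cart_gen[of "ker T"] by simp
  have "(mat 1 :: complex^3^3) *v axis 1 1 \<noteq> 0" by simp
  hence "(mat 1 :: complex^3^3) \<noteq> 0" by (metis matrix_vector_mult_0)
  hence "P (mat 1)" by (simp add: P_def cspan_one)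
  \<comment> \<open>Kernels have dimension at most 3, so 4 is a strict upper bound.\<close>
  then obtain T where T: "P T" and max: "\<And>T'. P T' \<Longrightarrow> vec.dim (ker T') \<le> vec.dim (ker T)"
    using ex_has_greatest_nat[of P "mat 1" "\<lambda>T. vec.dim (ker T)" 4]
      le_imp_less_Suc[OF bound] by auto
  obtain x1 where x1: "T *v x1 \<noteq> 0"
    using T matrix_eqI[of T 0] by (auto simp: P_def)
  define u where "u = T *v x1"
  have multiple: "\<exists>c. T *v x = c *s u" for x
  proof (rule ccontr)
    assume no: "\<nexists>c. T *v x = c *s u"
    \<comment> \<open>With \<open>A *v u = x\<close> the operator \<open>B\<close> sends
      \<open>u\<close> to \<open>T *v x\<close>, which is not a multiple of \<open>u\<close>; this
      keeps \<open>T'\<close> nonzero.\<close>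
    obtain A where A: "A \<in> cspan S" "A *v u = x"
      using cspan_transitive[OF irr x1, of x] unfolding u_def .
    define B where "B = T ** A"
    obtain y l where y: "y \<in> range ((*v) T)" "y \<noteq> 0" "B *v y = l *s y"
    proof (rule eigenvector_in_invariant_subspace[of "range ((*v) T)" B u])
      show "vec.subspace (range ((*v) T))"
        by (simp add: vec.subspace_image)
      show "B *v v \<in> range ((*v) T)" for v
        by (simp add: B_def flip: matrix_vector_mul_assoc)
    qed (use x1 in \<open>auto simp: u_def\<close>)
    then obtain x0 where x0: "y = T *v x0" by blast
    define T' where "T' = (B + mat (- l)) ** T"
    have T': "T' *v v = B *v (T *v v) - l *s (T *v v)" for v
      by (simp add: T'_def matrix_vector_mult_add_rdistrib mat_vector_mult
          flip: matrix_vector_mul_assoc)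
    have "T' *v x1 = T *v x - l *s u"
      using A by (simp add: T' B_def u_def flip: matrix_vector_mul_assoc)
    hence "T' *v x1 \<noteq> 0" using no by auto
    hence "T' \<noteq> 0" by auto
    moreover have "T' \<in> cspan S"
      using T A unfolding T'_def B_def P_def
      by (intro cspan_mult cspan_add cspan_one) auto
    ultimately have "vec.dim (ker T') \<le> vec.dim (ker T)"
      using max by (simp add: P_def)
    moreover have "ker T \<subseteq> ker T'" by (auto simp: ker_def T')
    ultimately have "ker T = ker T'"
      using vec.subspace_dim_equal subspace_ker by blast
    moreover have "x0 \<in> ker T'" "x0 \<notin> ker T" using y x0 by (auto simp: ker_def T')
    ultimately show False by simp
  qed
  then obtain f where f: "\<And>x. T *v x = f x *s u" by metis
  have "u \<noteq> 0" using x1 u_def by simp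
  then obtain k where k: "u $ k \<noteq> 0" by (auto simp: vec_eq_iff)
  \<comment> \<open>Row \<open>k\<close> of \<open>T\<close> divided by \<open>u $ k\<close> is the
    functional \<open>f\<close>; conjugating and reversing it gives the vector representing
    \<open>f\<close> through \<open>herm\<close>.\<close>
  define g :: "complex^3" where
    "g = vector [cnj (T $ k $ 3 / u $ k), cnj (T $ k $ 2 / u $ k), cnj (T $ k $ 1 / u $ k)]"
  have fg: "f x = herm x g" for x
  proof -
    have "(T *v x) $ k = f x * u $ k" by (simp add: f)
    hence "f x = (T *v x) $ k / u $ k" using k by simp
    also have "\<dots> = herm x g"
      using k by (simp add: matrix_vector_mult_def sum_3 herm_def g_def field_simps)
    finally show ?thesis .
  qed
  have "T = rank_one u g"
    by (rule matrix_eqI) (simp add: f fg rank_one_apply)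
  moreover have "g \<noteq> 0" using f[of x1] x1 fg by auto
  ultimately show thesis using that \<open>u \<noteq> 0\<close> T P_def by blast
qed

text \<open>Left multiplication moves the first vector of one rank-one element anywhere. The vectors
  \<open>h\<close> that may occur in the second place form a subspace, which is invariant because
  the adjoint of a unitary matrix is its inverse. By irreducibility every rank-one matrix is
  reached, and these span everything.\<close>

theorem burnside:
  assumes irr: "acts_irreducibly S"
  shows "cspan S = UNIV"
proof -
  obtain u g where ug: "u \<noteq> 0" "g \<noteq> 0" "rank_one u g \<in> cspan S"
    using cspan_rank_one[OF irr] .
  let ?F = "{h. \<forall>z. rank_one z h \<in> cspan S}"
  have "rank_one z g \<in> cspan S" for z
  proof -
    obtain M where "M \<in> cspan S" "M *v u = z" using cspan_transitive[OF irr ug(1)] .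
    moreover from this have "M ** rank_one u g = rank_one z g"
      by (intro matrix_eqI) (simp add: rank_one_apply vec.scale flip: matrix_vector_mul_assoc)
    ultimately show ?thesis using cspan_mult ug(3) by metis
  qed
  hence g: "g \<in> ?F" by simp
  have "vec.subspace ?F"
    unfolding vec.subspace_def
  proof (intro conjI allI impI ballI)
    have "rank_one z 0 = mat 0" for z
      by (rule matrix_eqI) (simp add: rank_one_apply mat_vector_mult)
    thus "0 \<in> ?F" using cspan_one[of 0] by simp
  next
    fix h h' assume "h \<in> ?F" "h' \<in> ?F"
    moreover have "rank_one z (h + h') = rank_one z h + rank_one z h'" for z
      by (rule matrix_eqI)
        (simp add: rank_one_apply herm_simps matrix_vector_mult_add_rdistrib vec.scale_left_distrib)
    ultimately show "h + h' \<in> ?F" by (simp add: cspan_add)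
  next
    fix c h assume "h \<in> ?F"
    moreover have "rank_one z (c *s h) = mat (cnj c) ** rank_one z h" for z
      by (rule matrix_eqI)
        (simp add: rank_one_apply herm_simps mat_vector_mult flip: matrix_vector_mul_assoc)
    ultimately show "c *s h \<in> ?F" by (simp add: cspan_scale)
  qed
  moreover have "A *v h \<in> ?F" if A: "A \<in> S" and h: "h \<in> ?F" for A h
  proof -
    obtain B where B: "B \<in> S" "A ** B = mat 1" using inverse[OF A] by blast
    have "herm (B *v v) h = herm v (A *v h)" for v
      using herm_invariant[OF A, of "B *v v" h] B by (simp add: matrix_vector_mul_assoc)
    hence "rank_one z (A *v h) = rank_one z h ** B" for z
      by (intro matrix_eqI) (simp add: rank_one_apply flip: matrix_vector_mul_assoc)
    thus ?thesis using h B cspan_mult cspan_base by auto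
  qed
  ultimately have "?F = UNIV" by (rule acts_irreduciblyD[OF irr _ _ g ug(2)])
  hence "rank_one z h \<in> cspan S" for z h by blast
  hence "M \<in> cspan S" for M
    by (subst matrix_as_rank_ones[of M]) (intro cspan_add)
  thus ?thesis by blast
qed

end

section \<open>Schur's lemma and invariant lines\<close>

text \<open>Schur's lemma without eigenvalues: \<open>T\<close> commutes with every matrix, in
  particular with the rank-one matrix that sends \<open>e\<close> to \<open>v\<close>. So
  \<open>T v\<close> is \<open>v\<close> times the first coordinate of \<open>T e\<close>, a factor
  independent of \<open>v\<close>.\<close>

lemma (in unitary_group) commuting_map_is_scalar:
  assumes full: "cspan S = UNIV"
    and add: "\<And>v w. T (v + w) = T v + T w"
    and scale: "\<And>c v. T (c *s v) = c *s T v"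
    and comm: "\<And>A v. A \<in> S \<Longrightarrow> T (A *v v) = A *v T v"
  shows "\<exists>c. \<forall>v. T v = c *s v"
proof -
  have "M \<in> cspan S \<Longrightarrow> T (M *v v) = M *v T v" for M v
    by (induction arbitrary: v rule: cspan.induct)
      (simp_all add: comm add scale matrix_vector_mult_add_rdistrib mat_vector_mult
        flip: matrix_vector_mul_assoc)
  hence T: "T (M *v v) = M *v T v" for M v using full by blast
  define e :: "complex^3" where "e = axis 1 1"
  have "v = rank_one v (axis 3 1) *v e" for v
    by (simp add: rank_one_apply herm_axis e_def)
  hence "T v = rank_one v (axis 3 1) *v T e" for v
    using T by metis
  thus ?thesis
    unfolding rank_one_apply herm_axis by blast
qed

text \<open>The cross product adapted to the form: \<open>herm z (hcross w x)\<close> is the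
  determinant with rows \<open>z\<close>, \<open>w\<close>, \<open>x\<close>. Nonvanishing of such
  an expression therefore encodes linear independence.\<close>

definition hcross :: "complex^3 \<Rightarrow> complex^3 \<Rightarrow> complex^3" where
  "hcross w x = vector [cnj (w $ 1 * x $ 2 - w $ 2 * x $ 1),
     cnj (w $ 3 * x $ 1 - w $ 1 * x $ 3), cnj (w $ 2 * x $ 3 - w $ 3 * x $ 2)]"

lemma hcross_nth:
  "hcross w x $ 1 = cnj (w $ 1 * x $ 2 - w $ 2 * x $ 1)"
  "hcross w x $ 2 = cnj (w $ 3 * x $ 1 - w $ 1 * x $ 3)"
  "hcross w x $ 3 = cnj (w $ 2 * x $ 3 - w $ 3 * x $ 2)"
  by (simp_all add: hcross_def)

lemma herm_hcross_self [simp]: "herm w (hcross w x) = 0" "herm x (hcross w x) = 0"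
  by (simp_all add: herm_def hcross_nth algebra_simps)

lemma herm_hcross_cyclic: "herm w (hcross x y) = herm y (hcross w x)"
  by (simp add: herm_def hcross_nth algebra_simps)

text \<open>Cramer's rule, with the determinants written as pairings.\<close>

lemma hcross_expansion:
  "herm y (hcross w x) *s z
     = herm z (hcross w x) *s y + herm z (hcross x y) *s w + herm z (hcross y w) *s x"
  by (simp add: vec_eq_iff forall_3 herm_def hcross_nth algebra_simps)

lemma hcross_eq_0_imp:
  assumes "hcross w x = 0" "w \<noteq> 0"
  obtains c where "x = c *s w"
proof -
  have *: "w $ 1 * x $ 2 = w $ 2 * x $ 1" "w $ 3 * x $ 1 = w $ 1 * x $ 3"
    "w $ 2 * x $ 3 = w $ 3 * x $ 2"
    using assms(1) by (simp_all add: vec_eq_iff forall_3 hcross_nth del: complex_cnj_mult complex_cnj_diff)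
  obtain k where k: "w $ k \<noteq> 0" using assms(2) by (auto simp: vec_eq_iff)
  have "x $ i = x $ k / w $ k * w $ i" for i
    using k * exhaust_3[of k] exhaust_3[of i] by (auto simp: field_simps)
  hence "x = (x $ k / w $ k) *s w"
    unfolding vec_eq_iff vector_smult_component by blast
  thus thesis using that by blast
qed

text \<open>By the expansion of a double cross product, each coordinate of
  \<open>hcross (hcross w x) z\<close> is, up to conjugation, a combination of the two orthogonality
  relations. It vanishes, so the two vectors are proportional.\<close>

lemma multiple_of_hcross:
  assumes "herm w z = 0" "herm x z = 0" "hcross w x \<noteq> 0"
  obtains c where "z = c *s hcross w x"
proof (rule hcross_eq_0_imp[of "hcross w x" z])
  define a where "a i = cnj (z $ i)" for i
  have z: "z $ i = cnj (a i)" for i by (simp add: a_def)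
  have *: "w $ 1 * a 3 + w $ 2 * a 2 + w $ 3 * a 1 = 0"
    "x $ 1 * a 3 + x $ 2 * a 2 + x $ 3 * a 1 = 0"
    using assms by (simp_all add: herm_def a_def)
  have "(w $ 1 * x $ 2 - w $ 2 * x $ 1) * a 2 - (w $ 3 * x $ 1 - w $ 1 * x $ 3) * a 1 =
      w $ 1 * (x $ 1 * a 3 + x $ 2 * a 2 + x $ 3 * a 1)
      - x $ 1 * (w $ 1 * a 3 + w $ 2 * a 2 + w $ 3 * a 1)"
    "(w $ 2 * x $ 3 - w $ 3 * x $ 2) * a 1 - (w $ 1 * x $ 2 - w $ 2 * x $ 1) * a 3 =
      w $ 2 * (x $ 1 * a 3 + x $ 2 * a 2 + x $ 3 * a 1)
      - x $ 2 * (w $ 1 * a 3 + w $ 2 * a 2 + w $ 3 * a 1)"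
    "(w $ 3 * x $ 1 - w $ 1 * x $ 3) * a 3 - (w $ 2 * x $ 3 - w $ 3 * x $ 2) * a 2 =
      w $ 3 * (x $ 1 * a 3 + x $ 2 * a 2 + x $ 3 * a 1)
      - x $ 3 * (w $ 1 * a 3 + w $ 2 * a 2 + w $ 3 * a 1)"
    by (simp_all add: algebra_simps)
  hence "(w $ 1 * x $ 2 - w $ 2 * x $ 1) * a 2 - (w $ 3 * x $ 1 - w $ 1 * x $ 3) * a 1 = 0"
    "(w $ 2 * x $ 3 - w $ 3 * x $ 2) * a 1 - (w $ 1 * x $ 2 - w $ 2 * x $ 1) * a 3 = 0"
    "(w $ 3 * x $ 1 - w $ 1 * x $ 3) * a 3 - (w $ 2 * x $ 3 - w $ 3 * x $ 2) * a 2 = 0"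
    unfolding * by simp_all
  thus "hcross (hcross w x) z = 0"
    by (simp add: vec_eq_iff forall_3 hcross_nth[of "hcross w x"] hcross_nth[of w] z
        del: complex_cnj_mult complex_cnj_diff flip: complex_cnj_mult complex_cnj_diff)
qed (use assms that in auto)

lemma orthogonal_vector_exists:
  obtains n where "n \<noteq> 0" "herm v n = 0"
proof (cases "v $ 1 = 0 \<and> v $ 2 = 0")
  case True
  have "axis 2 1 \<noteq> (0 :: complex^3)" by simp
  thus thesis using that[of "axis 2 1"] True by (simp add: herm_axis)
next
  case False
  have "herm v (vector [0, - cnj (v $ 1), cnj (v $ 2)]) = 0" by (simp add: herm_def)
  moreover have "vector [0, - cnj (v $ 1), cnj (v $ 2)] \<noteq> (0 :: complex^3)"
    using False by (auto simp: vec_eq_iff forall_3)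
  ultimately show thesis using that by blast
qed

lemma subspace_line: "vec.subspace (range (\<lambda>c. c *s v))" for v :: "complex^3"
proof -
  have "range (\<lambda>c. c *s v) = vec.span {v}" by (auto simp: vec.span_singleton)
  thus ?thesis by simp
qed

lemma line_not_UNIV: "range (\<lambda>c. c *s v) \<noteq> UNIV" for v :: "complex^3"
proof
  assume U: "range (\<lambda>c. c *s v) = UNIV"
  obtain n where n: "n \<noteq> 0" "herm v n = 0" by (rule orthogonal_vector_exists)
  have "herm w n = 0" for w
  proof -
    have "w \<in> range (\<lambda>c. c *s v)" using U by simp
    thus ?thesis using n by (auto simp: herm_simps)
  qed
  thus False using n herm_nondegenerate[of n] by (metis herm_eq0_sym)
qed

text \<open>A proper nonzero invariant subspace \<open>W\<close> is a line or a plane. In the second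
  case its orthogonal complement is a line, spanned by the cross product of two independent vectors
  of \<open>W\<close>, and is invariant by unitarity.\<close>

lemma (in unitary_group) invariant_line:
  assumes "\<not> acts_irreducibly S"
  obtains v where "v \<noteq> 0" "\<And>A. A \<in> S \<Longrightarrow> \<exists>c. A *v v = c *s v"
proof -
  obtain W where W: "vec.subspace W" "\<And>A v. A \<in> S \<Longrightarrow> v \<in> W \<Longrightarrow> A *v v \<in> W"
    and W': "W \<noteq> {0}" "W \<noteq> UNIV"
    using assms unfolding acts_irreducibly_def by blast
  obtain w where w: "w \<in> W" "w \<noteq> 0" using W' vec.subspace_0[OF W(1)] by blast
  show thesis
  proof (cases "\<forall>x\<in>W. \<exists>c. x = c *s w")
    case True
    thus thesis using that w W(2) by blast
  next
    case False
    then obtain x where x: "x \<in> W" "\<And>c. x \<noteq> c *s w" by blast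
    define v where "v = hcross w x"
    have v: "v \<noteq> 0" using x w hcross_eq_0_imp v_def by metis
    \<comment> \<open>Otherwise \<open>y\<close>, \<open>w\<close>, \<open>x\<close> is a basis
      contained in \<open>W\<close>, and Cramer's rule makes \<open>W\<close> the whole
      space.\<close>
    have orth: "herm y v = 0" if y: "y \<in> W" for y
    proof (rule ccontr)
      assume nz: "herm y v \<noteq> 0"
      have "z \<in> W" for z
      proof -
        have "herm y v *s z \<in> W"
          unfolding v_def hcross_expansion[of y w x z]
          by (intro vec.subspace_add vec.subspace_scale W w x y)
        hence "inverse (herm y v) *s (herm y v *s z) \<in> W" by (rule vec.subspace_scale[OF W(1)])
        moreover have "inverse (herm y v) *s (herm y v *s z) = z" using nz by simp
        ultimately show ?thesis by (simp only:)
      qed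
      thus False using W' by blast
    qed
    have "\<exists>c. A *v v = c *s v" if A: "A \<in> S" for A
    proof -
      obtain B where B: "B \<in> S" "A ** B = mat 1" using inverse A by blast
      have "herm y (A *v v) = 0" if "y \<in> W" for y
        using herm_invariant[OF A, of "B *v y" v] orth[OF W(2)[OF B(1) that]] B
        by (simp add: matrix_vector_mul_assoc)
      thus ?thesis using multiple_of_hcross[of w "A *v v" x] w x v v_def by metis
    qed
    thus thesis using that v by blast
  qed
qed

lemma proj_scale: "c \<noteq> 0 \<Longrightarrow> proj (c *s v) = proj v"
proof (intro equalityI subsetI)
  fix x assume c: "c \<noteq> 0" and "x \<in> proj v"
  then obtain d where "d \<noteq> 0" "x = d *s v" by (auto simp: proj_def)
  hence "d / c \<noteq> 0" "x = (d / c) *s (c *s v)" using c by simp_all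
  thus "x \<in> proj (c *s v)" unfolding proj_def by blast
next
  fix x assume c: "c \<noteq> 0" and "x \<in> proj (c *s v)"
  then obtain d where "d \<noteq> 0" "x = (d * c) *s v" by (auto simp: proj_def)
  moreover from this c have "d * c \<noteq> 0" by simp
  ultimately show "x \<in> proj v" unfolding proj_def by blast
qed

section \<open>Clifford theory\<close>

locale normal_pair = unitary_group S + sub: unitary_group N for S N +
  assumes subset: "N \<subseteq> S"
    and normal: "A \<in> S \<Longrightarrow> B \<in> S \<Longrightarrow> A ** B = mat 1 \<Longrightarrow> n \<in> N \<Longrightarrow> A ** n ** B \<in> N"
begin

definition has_character :: "complex^3 \<Rightarrow> (complex^3^3 \<Rightarrow> complex) \<Rightarrow> bool" where
  "has_character v \<kappa> \<longleftrightarrow> v \<noteq> 0 \<and> (\<forall>n\<in>N. n *v v = \<kappa> n *s v)"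

lemma mult_vec_cancel: "A ** B = mat 1 \<Longrightarrow> A *v (B *v v) = v" for A B :: "complex^3^3"
  by (simp add: matrix_vector_mul_assoc)

lemma has_character_conjugate:
  assumes v: "has_character v \<kappa>" and AB: "A \<in> S" "B \<in> S" "A ** B = mat 1" "B ** A = mat 1"
  shows "has_character (A *v v) (\<lambda>n. \<kappa> (B ** n ** A))"
proof -
  have "A *v v \<noteq> 0"
    using v mult_vec_cancel[OF AB(4), of v] by (auto simp: has_character_def)
  moreover have "n *v (A *v v) = \<kappa> (B ** n ** A) *s (A *v v)" if "n \<in> N" for n
  proof -
    have "A *v ((B ** n ** A) *v v) = n *v (A *v v)"
      using AB(3) by (simp add: mult_vec_cancel flip: matrix_vector_mul_assoc)
    moreover have "B ** n ** A \<in> N" by (rule normal[OF AB(2,1,4) that])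
    ultimately show ?thesis using v by (simp add: has_character_def vec.scale)
  qed
  ultimately show ?thesis by (simp add: has_character_def)
qed

lemma no_invariant_line:
  assumes "acts_irreducibly S" "v \<noteq> 0"
  shows "\<exists>A\<in>S. \<forall>c. A *v v \<noteq> c *s v"
proof (rule ccontr)
  assume "\<not> ?thesis"
  hence *: "\<exists>c. A *v v = c *s v" if "A \<in> S" for A using that by blast
  have "A *v w \<in> range (\<lambda>c. c *s v)" if "A \<in> S" "w \<in> range (\<lambda>c. c *s v)" for A w
    using *[OF that(1)] that(2) by (auto simp: vec.scale)
  moreover have "v = 1 *s v" by simp
  hence "v \<in> range (\<lambda>c. c *s v)" by (rule range_eqI)
  ultimately have "range (\<lambda>c. c *s v) = UNIV"
    by (rule acts_irreduciblyD[OF assms(1) subspace_line _ _ assms(2)])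
  thus False using line_not_UNIV by blast
qed

text \<open>The vectors carrying a character of \<open>N\<close> span an \<open>S\<close>-invariant subspace.\<close>

lemma has_character_basis:
  assumes irr: "acts_irreducibly S" and "has_character v \<kappa>"
  obtains v1 v2 v3 \<kappa>1 \<kappa>2 \<kappa>3 where "has_character v1 \<kappa>1" "has_character v2 \<kappa>2"
    "has_character v3 \<kappa>3" "herm v1 (hcross v2 v3) \<noteq> 0"
proof -
  let ?E = "{v. \<exists>\<kappa>. has_character v \<kappa>}"
  have nz: "v \<noteq> 0" if "v \<in> ?E" for v using that by (auto simp: has_character_def)
  have inv: "A *v w \<in> vec.span ?E" if A: "A \<in> S" and "w \<in> vec.span ?E" for A w
    using that(2)
  proof (induction rule: vec.span_induct_alt)
    case base
    show ?case by (simp add: vec.span_zero)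
  next
    case (step c x y)
    obtain B where "B \<in> S" "A ** B = mat 1" "B ** A = mat 1" using inverse A by blast
    hence "A *v x \<in> ?E" using step has_character_conjugate A by blast
    thus ?case using step
      by (simp add: matrix_vector_right_distrib vec.scale vec.span_add vec.span_scale vec.span_base)
  qed
  have "v \<in> vec.span ?E" using assms(2) by (intro vec.span_base) blast
  moreover have "v \<noteq> 0" using assms(2) by (simp add: has_character_def)
  ultimately have span: "vec.span ?E = UNIV"
    using acts_irreduciblyD[OF irr vec.subspace_span inv] by blast
  \<comment> \<open>Supplies vectors outside a given plane: used twice, it extends \<open>v\<close>
    to a basis of vectors with characters.\<close>
  have escape: "\<exists>y\<in>?E. herm y n \<noteq> 0" if "n \<noteq> 0" for n
  proof (rule ccontr)
    assume "\<not> ?thesis"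
    hence "?E \<subseteq> {y. herm y n = 0}" by blast
    moreover have "vec.subspace {y. herm y n = 0}"
      by (simp add: vec.subspace_def herm_simps)
    ultimately have "vec.span ?E \<subseteq> {y. herm y n = 0}" by (rule vec.span_minimal)
    hence "herm y n = 0" for y using span by blast
    hence "n = 0" using herm_nondegenerate[of n] herm_eq0_sym by blast
    thus False using that by blast
  qed
  obtain m where m: "m \<noteq> 0" "herm v m = 0" by (rule orthogonal_vector_exists)
  obtain w where w: "w \<in> ?E" "herm w m \<noteq> 0" using escape[OF m(1)] by blast
  have "hcross v w \<noteq> 0"
  proof
    assume "hcross v w = 0"
    then obtain c where "w = c *s v" using hcross_eq_0_imp \<open>v \<noteq> 0\<close> by blast
    thus False using w m by (simp add: herm_simps)
  qed
  from escape[OF this] obtain y where "y \<in> ?E" "herm y (hcross v w) \<noteq> 0" by blast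
  thus thesis using that w assms(2) by blast
qed

text \<open>Pairing with \<open>hcross v2 v3\<close> extracts the coefficient along
  \<open>v1\<close>. Computing that coefficient of \<open>n *v y\<close> in two ways shows that a
  vector with a nonzero component along \<open>v1\<close> has the character of
  \<open>v1\<close>.\<close>

lemma character_unique:
  assumes "has_character v1 \<kappa>1" "has_character v2 \<kappa>2" "has_character v3 \<kappa>3"
    and D: "herm v1 (hcross v2 v3) \<noteq> 0"
    and y: "has_character y \<psi>" and nz: "herm y (hcross v2 v3) \<noteq> 0" and n: "n \<in> N"
  shows "\<psi> n = \<kappa>1 n"
proof -
  define a b c where "a = herm y (hcross v2 v3)" and "b = herm y (hcross v3 v1)"
    and "c = herm y (hcross v1 v2)"
  have exp: "herm v1 (hcross v2 v3) *s y = a *s v1 + b *s v2 + c *s v3"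
    unfolding a_def b_def c_def by (rule hcross_expansion)
  have "herm v1 (hcross v2 v3) *s (n *v y) = n *v (a *s v1 + b *s v2 + c *s v3)"
    unfolding exp[symmetric] by (simp add: vec.scale)
  also have "\<dots> = (a * \<kappa>1 n) *s v1 + (b * \<kappa>2 n) *s v2 + (c * \<kappa>3 n) *s v3"
    using assms n by (simp add: has_character_def matrix_vector_right_distrib vec.scale)
  finally have "herm (herm v1 (hcross v2 v3) *s (n *v y)) (hcross v2 v3)
    = a * \<kappa>1 n * herm v1 (hcross v2 v3)"
    by (simp add: herm_simps)
  moreover have "n *v y = \<psi> n *s y" using y n by (simp add: has_character_def)
  ultimately have "herm v1 (hcross v2 v3) * (\<psi> n * a) = herm v1 (hcross v2 v3) * (\<kappa>1 n * a)"
    by (simp add: herm_simps a_def)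
  thus ?thesis using D nz a_def by simp
qed

lemma multiple_of_basis_vector:
  assumes "herm v1 (hcross v2 v3) \<noteq> 0" "y \<noteq> 0"
    "herm y (hcross v3 v1) = 0" "herm y (hcross v1 v2) = 0"
  obtains c where "c \<noteq> 0" "y = c *s v1"
proof -
  let ?D = "herm v1 (hcross v2 v3)"
  have "?D *s y = herm y (hcross v2 v3) *s v1"
    using hcross_expansion[of v1 v2 v3 y] assms by simp
  hence "inverse ?D *s (?D *s y) = inverse ?D *s (herm y (hcross v2 v3) *s v1)" by simp
  hence "y = (inverse ?D * herm y (hcross v2 v3)) *s v1" using assms(1) by simp
  thus thesis using that assms(2) by (metis vec.scale_zero_left)
qed

text \<open>The vectors with character \<kappa>1 would form a line and those with \<kappa>2 a plane.
  Irreducibility gives \<open>A\<close> in \<open>S\<close> moving \<open>v1\<close> off its line;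
  then \<open>A *v v1\<close> has character \<kappa>2, and \<open>A\<close> carries one eigenspace
  onto the other. A line cannot be mapped onto a plane.\<close>

lemma no_isolated_character:
  assumes irr: "acts_irreducibly S"
    and ch: "has_character v1 \<kappa>1" "has_character v2 \<kappa>2" "has_character v3 \<kappa>3"
    and D: "herm v1 (hcross v2 v3) \<noteq> 0"
    and ne: "\<exists>n\<in>N. \<kappa>1 n \<noteq> \<kappa>2 n" and eq: "\<forall>n\<in>N. \<kappa>2 n = \<kappa>3 n"
  shows False
proof -
  have D2: "herm v2 (hcross v3 v1) \<noteq> 0" and D3: "herm v3 (hcross v1 v2) \<noteq> 0"
    using D by (simp_all add: herm_hcross_cyclic)
  note u1 = character_unique[OF ch D]
  note u2 = character_unique[OF ch(2,3,1) D2]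
  note u3 = character_unique[OF ch(3,1,2) D3]
  have char1: "\<exists>c. c \<noteq> 0 \<and> y = c *s v1" if y: "has_character y \<psi>" "\<forall>n\<in>N. \<psi> n = \<kappa>1 n" for y \<psi>
  proof -
    have "herm y (hcross v3 v1) = 0" "herm y (hcross v1 v2) = 0"
      using u2[OF y(1)] u3[OF y(1)] y(2) ne eq by metis+
    thus ?thesis using multiple_of_basis_vector[OF D] y(1) has_character_def by metis
  qed
  have "v1 \<noteq> 0" using ch by (simp add: has_character_def)
  then obtain A where A: "A \<in> S" "\<And>c. A *v v1 \<noteq> c *s v1"
    using no_invariant_line[OF irr] by blast
  obtain B where B: "B \<in> S" "A ** B = mat 1" "B ** A = mat 1" using inverse A by blast
  define \<psi> where "\<psi> n = \<kappa>1 (B ** n ** A)" for n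
  have \<psi>: "has_character (A *v v1) \<psi>"
    unfolding \<psi>_def by (rule has_character_conjugate[OF ch(1) A(1) B])
  have "herm (A *v v1) (hcross v2 v3) = 0"
    using u1[OF \<psi>] char1[OF \<psi>] A(2) by blast
  moreover have "A *v v1 \<noteq> 0" using \<psi> by (simp add: has_character_def)
  ultimately have "herm (A *v v1) (hcross v3 v1) \<noteq> 0 \<or> herm (A *v v1) (hcross v1 v2) \<noteq> 0"
    using hcross_expansion[of v1 v2 v3 "A *v v1"] D by auto
  hence \<psi>2: "\<psi> n = \<kappa>2 n" if "n \<in> N" for n
    using u2[OF \<psi> _ that] u3[OF \<psi> _ that] eq that by auto
  have "\<exists>c. w = c *s (A *v v1)" if w: "has_character w \<kappa>2" for w
  proof -
    have "has_character (B *v w) (\<lambda>n. \<kappa>2 (A ** n ** B))"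
      by (rule has_character_conjugate[OF w B(1) A(1) B(3,2)])
    moreover have "\<forall>n\<in>N. \<kappa>2 (A ** n ** B) = \<kappa>1 n"
    proof
      fix n assume n: "n \<in> N"
      have "A ** n ** B \<in> N" by (rule normal[OF A(1) B(1,2) n])
      moreover have "B ** (A ** n ** B) ** A = n"
        using B by (metis matrix_mul_assoc matrix_mul_lid matrix_mul_rid)
      ultimately show "\<kappa>2 (A ** n ** B) = \<kappa>1 n" using \<psi>2 by (metis \<psi>_def)
    qed
    ultimately obtain c where "B *v w = c *s v1" using char1 by blast
    hence "A *v (B *v w) = c *s (A *v v1)" by (simp add: vec.scale)
    thus ?thesis using mult_vec_cancel[OF B(2)] by auto
  qed
  moreover have "has_character v3 \<kappa>2" using ch(3) eq by (simp add: has_character_def)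
  ultimately obtain c d where "v2 = c *s (A *v v1)" "v3 = d *s (A *v v1)" using ch(2) by blast
  hence "hcross v2 v3 = 0" by (simp add: vec_eq_iff forall_3 hcross_nth)
  thus False using D by simp
qed

text \<open>Invariance of \<open>herm w w\<close> makes \<open>\<psi> n\<close> unimodular, and
  invariance of \<open>herm v w\<close> makes \<open>\<kappa> n\<close> the inverse of
  \<open>cnj (\<psi> n)\<close>.\<close>

lemma characters_of_nonorthogonal:
  assumes "has_character v \<kappa>" "has_character w \<psi>" "herm v w \<noteq> 0" "herm w w \<noteq> 0" "n \<in> N"
  shows "\<kappa> n = \<psi> n"
proof -
  have "herm v w = \<kappa> n * cnj (\<psi> n) * herm v w"
    using sub.herm_invariant[of n v w] assms by (simp add: has_character_def herm_scale)
  moreover have "herm w w = \<psi> n * cnj (\<psi> n) * herm w w"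
    using sub.herm_invariant[of n w w] assms by (simp add: has_character_def herm_scale)
  ultimately have "\<kappa> n * cnj (\<psi> n) = 1" "\<psi> n * cnj (\<psi> n) = 1" using assms by auto
  thus ?thesis by (metis mult_cancel_right mult_zero_right zero_neq_one)
qed

text \<open>Distinct characters have only the three basis lines as eigenlines, so \<open>S\<close>
  permutes these and each has a finite orbit. If all three were positive, they would be pairwise
  orthogonal and the form would be positive definite.\<close>

lemma distinct_characters:
  assumes ch: "has_character v1 \<kappa>1" "has_character v2 \<kappa>2" "has_character v3 \<kappa>3"
    and D: "herm v1 (hcross v2 v3) \<noteq> 0"
    and ne: "\<exists>n\<in>N. \<kappa>1 n \<noteq> \<kappa>2 n" "\<exists>n\<in>N. \<kappa>2 n \<noteq> \<kappa>3 n" "\<exists>n\<in>N. \<kappa>3 n \<noteq> \<kappa>1 n"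
  obtains v where "v \<noteq> 0" "Re (herm v v) \<le> 0" "finite {proj (A *v v) | A. A \<in> S}"
proof -
  have D2: "herm v2 (hcross v3 v1) \<noteq> 0" and D3: "herm v3 (hcross v1 v2) \<noteq> 0"
    using D by (simp_all add: herm_hcross_cyclic)
  note u1 = character_unique[OF ch D]
  note u2 = character_unique[OF ch(2,3,1) D2]
  note u3 = character_unique[OF ch(3,1,2) D3]
  have line: "proj y \<in> {proj v1, proj v2, proj v3}" if y: "has_character y \<psi>" for y \<psi>
  proof -
    have y0: "y \<noteq> 0" using y by (simp add: has_character_def)
    consider "herm y (hcross v2 v3) \<noteq> 0" | "herm y (hcross v3 v1) \<noteq> 0" | "herm y (hcross v1 v2) \<noteq> 0"
      using hcross_expansion[of v1 v2 v3 y] D y0 by fastforce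
    hence "(\<exists>c. c \<noteq> 0 \<and> y = c *s v1) \<or> (\<exists>c. c \<noteq> 0 \<and> y = c *s v2) \<or> (\<exists>c. c \<noteq> 0 \<and> y = c *s v3)"
    proof cases
      case 1
      hence "herm y (hcross v3 v1) = 0" "herm y (hcross v1 v2) = 0"
        using u1[OF y] u2[OF y] u3[OF y] ne by metis+
      thus ?thesis using multiple_of_basis_vector[OF D y0] by metis
    next
      case 2
      hence "herm y (hcross v1 v2) = 0" "herm y (hcross v2 v3) = 0"
        using u1[OF y] u2[OF y] u3[OF y] ne by metis+
      thus ?thesis using multiple_of_basis_vector[OF D2 y0] by metis
    next
      case 3
      hence "herm y (hcross v2 v3) = 0" "herm y (hcross v3 v1) = 0"
        using u1[OF y] u2[OF y] u3[OF y] ne by metis+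
      thus ?thesis using multiple_of_basis_vector[OF D3 y0] by metis
    qed
    thus ?thesis using proj_scale by auto
  qed
  have fin: "finite {proj (A *v v) | A. A \<in> S}" if v: "has_character v \<kappa>" for v \<kappa>
  proof (rule finite_subset)
    show "{proj (A *v v) | A. A \<in> S} \<subseteq> {proj v1, proj v2, proj v3}"
      using line has_character_conjugate[OF v] inverse by blast
  qed simp
  show thesis
  proof (cases "Re (herm v1 v1) \<le> 0 \<or> Re (herm v2 v2) \<le> 0 \<or> Re (herm v3 v3) \<le> 0")
    case True
    then obtain v \<kappa> where v: "has_character v \<kappa>" "Re (herm v v) \<le> 0" using ch by blast
    hence "v \<noteq> 0" by (simp add: has_character_def)
    thus thesis by (rule that[OF _ v(2) fin[OF v(1)]])
  next
    case False
    hence pos: "herm v1 v1 \<noteq> 0" "herm v2 v2 \<noteq> 0" "herm v3 v3 \<noteq> 0" by auto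
    have orth: "herm v1 v2 = 0" "herm v2 v3 = 0" "herm v3 v1 = 0"
      using characters_of_nonorthogonal ch pos ne by metis+
    hence orth': "herm v2 v1 = 0" "herm v3 v2 = 0" "herm v1 v3 = 0"
      using herm_eq0_sym by blast+
    \<comment> \<open>A vector of norm -2, expanded in the orthogonal basis to contradict
      positivity.\<close>
    define z :: "complex^3" where "z = vector [1, 0, -1]"
    define d where "d = herm v1 (hcross v2 v3)"
    obtain a b c where "d *s z = a *s v1 + b *s v2 + c *s v3"
      unfolding d_def using hcross_expansion by blast
    hence "herm (d *s z) (d *s z) =
      a * cnj a * herm v1 v1 + b * cnj b * herm v2 v2 + c * cnj c * herm v3 v3"
      by (simp add: herm_simps orth orth')
    moreover have "herm z z = -2" by (simp add: z_def herm_def)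
    ultimately have "d * cnj d * (-2) =
      a * cnj a * herm v1 v1 + b * cnj b * herm v2 v2 + c * cnj c * herm v3 v3"
      by (simp add: herm_scale)
    hence "Re (d * cnj d * (-2)) =
      Re (a * cnj a * herm v1 v1 + b * cnj b * herm v2 v2 + c * cnj c * herm v3 v3)"
      by simp
    hence "- 2 * (cmod d)\<^sup>2 = (cmod a)\<^sup>2 * Re (herm v1 v1) + (cmod b)\<^sup>2 * Re (herm v2 v2)
      + (cmod c)\<^sup>2 * Re (herm v3 v3)"
      by (simp flip: complex_norm_square)
    moreover have "\<dots> \<ge> 0" using False by (intro add_nonneg_nonneg mult_nonneg_nonneg) auto
    moreover have "d \<noteq> 0" using D d_def by simp
    hence "(cmod d)\<^sup>2 > 0" by simp
    ultimately show thesis by linarith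
  qed
qed

text \<open>Among the three characters of a basis it is impossible that exactly two agree (one would
  be isolated) or that none agree (a finite orbit would result). So all three agree.\<close>

theorem reducible_normal_subgroup_scalar:
  assumes irr: "acts_irreducibly S" and red: "\<not> acts_irreducibly N"
    and orbits: "\<And>v. v \<noteq> 0 \<Longrightarrow> Re (herm v v) \<le> 0 \<Longrightarrow> infinite {proj (A *v v) | A. A \<in> S}"
    and n: "n \<in> N"
  obtains c where "n = mat c"
proof -
  obtain v where v: "v \<noteq> 0" "\<And>n. n \<in> N \<Longrightarrow> \<exists>c. n *v v = c *s v"
    by (rule sub.invariant_line[OF red]) blast
  then obtain \<kappa> where "has_character v \<kappa>" unfolding has_character_def by metis
  from has_character_basis[OF irr this]
  obtain v1 v2 v3 \<kappa>1 \<kappa>2 \<kappa>3 where ch: "has_character v1 \<kappa>1" "has_character v2 \<kappa>2"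
    "has_character v3 \<kappa>3" and D: "herm v1 (hcross v2 v3) \<noteq> 0" .
  have D2: "herm v2 (hcross v3 v1) \<noteq> 0" and D3: "herm v3 (hcross v1 v2) \<noteq> 0"
    using D by (simp_all add: herm_hcross_cyclic)
  define e12 e23 e31 where "e12 \<longleftrightarrow> (\<forall>n\<in>N. \<kappa>1 n = \<kappa>2 n)" and "e23 \<longleftrightarrow> (\<forall>n\<in>N. \<kappa>2 n = \<kappa>3 n)"
    and "e31 \<longleftrightarrow> (\<forall>n\<in>N. \<kappa>3 n = \<kappa>1 n)"
  have "\<not> (\<not> e12 \<and> e23)" "\<not> (\<not> e23 \<and> e31)" "\<not> (\<not> e31 \<and> e12)"
    using no_isolated_character[OF irr ch D] no_isolated_character[OF irr ch(2,3,1) D2]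
      no_isolated_character[OF irr ch(3,1,2) D3] unfolding e12_def e23_def e31_def by blast+
  moreover have "e12 \<or> e23 \<or> e31"
  proof (rule ccontr)
    assume "\<not> (e12 \<or> e23 \<or> e31)"
    hence ne: "\<exists>n\<in>N. \<kappa>1 n \<noteq> \<kappa>2 n" "\<exists>n\<in>N. \<kappa>2 n \<noteq> \<kappa>3 n" "\<exists>n\<in>N. \<kappa>3 n \<noteq> \<kappa>1 n"
      unfolding e12_def e23_def e31_def by blast+
    obtain v where v: "v \<noteq> 0" "Re (herm v v) \<le> 0" "finite {proj (A *v v) | A. A \<in> S}"
      by (rule distinct_characters[OF ch D ne])
    show False using orbits[OF v(1,2)] v(3) by contradiction
  qed
  ultimately have e: "e12" "e23" by blast+
  have "n = mat (\<kappa>1 n)"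
  proof (rule matrix_eqI)
    fix y
    let ?D = "herm v1 (hcross v2 v3)"
    obtain a b c where y: "?D *s y = a *s v1 + b *s v2 + c *s v3"
      using hcross_expansion by blast
    have "n *v (?D *s y) = \<kappa>1 n *s (?D *s y)"
      using ch n e unfolding y e12_def e23_def has_character_def
      by (simp add: matrix_vector_right_distrib vec.scale vec.scale_right_distrib mult.commute)
    hence "?D *s (n *v y) = ?D *s (\<kappa>1 n *s y)" by (simp add: vec.scale mult.commute)
    thus "n *v y = mat (\<kappa>1 n) *v y"
      using D unfolding vec.scale_cancel_left by (simp add: mat_vector_mult)
  qed
  thus thesis by (rule that)
qed

end

section \<open>Groups of exponent three\<close>

lemma trace_rank_one: "trace (rank_one z g) = herm z g"
  by (simp add: trace_def rank_one_def herm_def axis_def sum_3 algebra_simps)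

lemma mult_rank_one: "M ** rank_one z g = rank_one (M *v z) g"
  by (rule matrix_eqI) (simp add: rank_one_apply vec.scale flip: matrix_vector_mul_assoc)

lemma trace_form_nondegenerate:
  fixes M :: "complex^3^3"
  assumes "\<And>Y. trace (M ** Y) = 0"
  shows "M = 0"
proof (rule matrix_eqI)
  fix z
  have "herm (M *v z) g = 0" for g
    using assms[of "rank_one z g"] by (simp add: mult_rank_one trace_rank_one)
  thus "M *v z = 0 *v z" using herm_nondegenerate[of "M *v z"] by simp
qed

lemma matrix_diff_rdistrib: "(A - B) ** C = A ** C - B ** C" for A B C :: "complex^3^3"
  by (rule matrix_eqI) (simp add: matrix_vector_mult_diff_rdistrib flip: matrix_vector_mul_assoc)

lemma trace_mat_mult: "trace (mat c ** M) = c * trace M" for M :: "complex^3^3"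
  by (simp add: trace_def matrix_matrix_mult_def mat_def sum_3 algebra_simps)

lemma trace_mult_add_right: "trace (M ** (Y + Z)) = trace (M ** Y) + trace (M ** Z)"
  for M :: "complex^3^3"
  by (simp add: matrix_add_ldistrib trace_add)

lemma trace_mult_scale_right: "trace (M ** (mat c ** Y)) = c * trace (M ** Y)"
  for M :: "complex^3^3"
proof -
  have "M ** (mat c ** Y) = mat c ** (M ** Y)"
    by (simp only: matrix_mul_assoc mat_commutes[of c M])
  thus ?thesis by (simp add: trace_mat_mult)
qed

lemma scaleR_eq_mat_mult: "r *\<^sub>R M = mat (of_real r) ** M" for M :: "complex^3^3"
proof -
  have "(r *\<^sub>R M) $ i $ k = of_real r * M $ i $ k" for i k
    by (metis vector_scaleR_component scaleR_conv_of_real)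
  thus ?thesis
    unfolding vec_eq_iff
    by (simp add: matrix_matrix_mult_def mat_def if_distrib if_distribR cong: if_cong)
qed

text \<open>The eigenvalues are cube roots of unity with product 1, so they are all distinct or all
  equal. The proof obtains this from the Cayley-Hamilton equation, traced directly and after
  multiplication by \<open>A\<close>. What matters is that only finitely many traces occur.\<close>

lemma trace_of_cube_root_of_unity:
  fixes A :: "complex^3^3"
  assumes cube: "A ** A ** A = mat 1" and det: "det A = 1"
  shows "trace A = 0 \<or> (trace A) ^ 3 = 27"
proof -
  define t s where "t = trace A" and "s = trace (A ** A)"
  define e where "e = (t\<^sup>2 - s) / 2"
  have "A ** A ** A + mat e ** A = mat t ** (A ** A) + mat 1"
    unfolding e_def t_def s_def using cayley_hamilton_3[of A] det by simp
  hence *: "mat e ** A = mat t ** (A ** A)" by (simp add: cube)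
  hence "e * t = t * s" by (metis trace_mat_mult t_def s_def)
  have "mat e ** (A ** A) = mat t ** (A ** A ** A)"
    using arg_cong[OF *, of "\<lambda>M. M ** A"] by (simp add: matrix_mul_assoc)
  hence "trace (mat e ** (A ** A)) = trace (mat t ** (mat 1 :: complex^3^3))" by (simp add: cube)
  hence es: "e * s = 3 * t"
    by (simp only: trace_mat_mult s_def trace_I) simp
  show ?thesis
  proof (cases "t = 0")
    case False
    hence "e = s" using \<open>e * t = t * s\<close> by simp
    hence t2: "t\<^sup>2 = 3 * s" by (simp add: e_def field_simps)
    have "27 * t = (3 * s)\<^sup>2" using es \<open>e = s\<close> by (simp add: power2_eq_square)
    also have "\<dots> = t ^ 3 * t" unfolding t2[symmetric] by (simp add: power2_eq_square power3_eq_cube)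
    finally show ?thesis using False by (simp add: t_def)
  qed (simp add: t_def)
qed

text \<open>Burnside's argument: an element \<open>M\<close> is determined by the traces of
  \<open>M ** Y\<close> for \<open>Y\<close> in a finite basis \<open>B\<close> chosen inside
  \<open>S\<close>, because \<open>S\<close> spans all matrices and the trace form is nondegenerate.
  Each of these traces belongs to the finite set \<open>T\<close>.\<close>

lemma (in unitary_group) finite_of_exponent_three:
  assumes irr: "acts_irreducibly S"
    and cube: "\<And>A. A \<in> S \<Longrightarrow> A ** A ** A = mat 1" and det: "\<And>A. A \<in> S \<Longrightarrow> det A = 1"
  shows "finite S"
proof -
  define T where "T = insert 0 {t :: complex. t ^ 3 = 27}"
  have "finite T" unfolding T_def by (simp add: finite_nth_roots)
  obtain B where B: "B \<subseteq> S" "independent B" "S \<subseteq> span B"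
    by (rule maximal_independent_subset)
  have "finite B" using B(2) by (rule independent_imp_finite)
  define f where "f M = restrict (\<lambda>Y. trace (M ** Y)) B" for M
  have "f ` S \<subseteq> PiE B (\<lambda>_. T)"
  proof
    fix h assume "h \<in> f ` S"
    then obtain M where M: "M \<in> S" "h = f M" by blast
    have "trace (M ** Y) \<in> T" if "Y \<in> B" for Y
    proof -
      have "M ** Y \<in> S" using mult M B that by blast
      thus ?thesis using trace_of_cube_root_of_unity cube det by (auto simp: T_def)
    qed
    thus "h \<in> PiE B (\<lambda>_. T)" by (simp add: M f_def)
  qed
  moreover have "finite (PiE B (\<lambda>_. T))" using \<open>finite B\<close> \<open>finite T\<close> by (intro finite_PiE)
  ultimately have "finite (f ` S)" by (rule finite_subset)
  moreover have "inj_on f S"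
  proof (rule inj_onI)
    fix M M' assume eq: "f M = f M'"
    have "trace (M ** Y) = trace (M' ** Y)" if "Y \<in> B" for Y
      using fun_cong[OF eq, of Y] that by (simp add: f_def)
    hence onB: "trace ((M - M') ** Y) = 0" if "Y \<in> B" for Y
      using that by (simp add: matrix_diff_rdistrib trace_sub)
    have span: "trace ((M - M') ** Y) = 0" if "Y \<in> span B" for Y
      using that
      by (induction rule: span_induct_alt)
        (simp_all add: onB trace_mult_add_right scaleR_eq_mat_mult trace_mult_scale_right
          trace_0[simplified])
    have "trace ((M - M') ** Y) = 0" if "Y \<in> cspan S" for Y
      using that
    proof induction
      case (cspan_base Y)
      thus ?case using span B(3) by blast
    qed (simp_all add: trace_mult_add_right trace_mult_scale_right)
    hence "M - M' = 0" using burnside[OF irr] by (intro trace_form_nondegenerate) blast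
    thus "M = M'" by simp
  qed
  ultimately show ?thesis by (simp add: finite_image_iff)
qed

section \<open>Invariant antilinear maps\<close>

definition vconj :: "complex^3 \<Rightarrow> complex^3" where
  "vconj v = (\<chi> i. cnj (v $ i))"

lemma vconj_vconj [simp]: "vconj (vconj v) = v"
  by (simp add: vconj_def vec_eq_iff)

lemma herm_vconj: "herm (vconj v) (vconj w) = herm w v"
  by (simp add: herm_def vconj_def algebra_simps)

locale antilinear_map =
  fixes j :: "complex^3 \<Rightarrow> complex^3"
  assumes j_add: "j (v + w) = j v + j w"
    and j_scale: "j (c *s v) = cnj c *s j v"
begin

lemma j_0 [simp]: "j 0 = 0"
  using j_scale[of 0 0] by simp

lemma j_diff: "j (v - w) = j v - j w"
  using j_add[of "v - w" w] by simp

lemma j_expansion: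
  "j v = cnj (v $ 1) *s j (axis 1 1) + cnj (v $ 2) *s j (axis 2 1) + cnj (v $ 3) *s j (axis 3 1)"
proof -
  have "v = v $ 1 *s axis 1 1 + v $ 2 *s axis 2 1 + v $ 3 *s axis 3 1"
    by (simp add: vec_eq_iff forall_3 axis_def)
  from arg_cong[OF this, of j] show ?thesis by (simp only: j_add j_scale)
qed

definition J :: "complex^3^3" where
  "J = (\<chi> i k. j (axis k 1) $ i)"

lemma J_vconj: "J *v vconj v = j v"
  unfolding j_expansion[of v]
  by (simp add: vec_eq_iff J_def vconj_def matrix_vector_mult_def sum_3 mult.commute)

lemma J_apply: "J *v v = j (vconj v)"
  using J_vconj[of "vconj v"] by simp

text \<open>As \<open>j\<close> is \<open>J\<close> after \<open>vconj\<close>, its square is the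
  product of \<open>J\<close> with its entrywise conjugate.\<close>

lemma det_J_of_square:
  assumes "\<And>v. j (j v) = c *s v"
  shows "det J * cnj (det J) = c ^ 3"
proof -
  define K :: "complex^3^3" where "K = (\<chi> i k. cnj (J $ i $ k))"
  have K: "vconj (J *v v) = K *v vconj v" for v
    by (simp add: vec_eq_iff vconj_def K_def matrix_vector_mult_def)
  have "J ** K = mat c"
  proof (rule matrix_eqI)
    fix v
    have "J *v (K *v v) = j (j v)"
      using K[of "vconj v"] by (metis J_vconj vconj_vconj)
    thus "(J ** K) *v v = mat c *v v"
      using assms by (simp add: mat_vector_mult flip: matrix_vector_mul_assoc)
  qed
  moreover have "det K = cnj (det J)" by (simp add: det_3 K_def)
  moreover have "det (mat c :: complex^3^3) = c ^ 3"
    by (simp add: det_3 mat_def power3_eq_cube)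
  ultimately show ?thesis by (metis det_mul)
qed

text \<open>Evaluating the threefold iterate of \<open>j\<close> in two ways shows that
  \<open>c\<close> is real. Its cube is the squared modulus of \<open>det J\<close>; as the exponent
  is odd, \<open>c\<close> is not negative.\<close>

lemma square_pos:
  assumes sq: "\<And>v. j (j v) = c *s v" and "c \<noteq> 0"
  obtains r where "r > 0" "c = of_real r"
proof -
  define e :: "complex^3" where "e = axis 1 1"
  have e: "e \<noteq> 0" by (simp add: e_def)
  have je: "j e \<noteq> 0"
  proof
    assume "j e = 0"
    hence "c *s e = 0" using sq[of e] by simp
    thus False using \<open>c \<noteq> 0\<close> e by simp
  qed
  have "cnj c *s j e = c *s j e"
    using sq[of "j e"] arg_cong[OF sq[of e], of j] by (simp add: j_scale)
  hence "cnj c = c" using je by simp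
  then obtain r where r: "c = of_real r" by (metis Reals_cases Reals_cnj_iff)
  have "complex_of_real ((cmod (det J))\<^sup>2) = det J * cnj (det J)"
    by (rule complex_norm_square)
  also have "\<dots> = of_real (r ^ 3)"
    using det_J_of_square[OF sq] r by simp
  finally have "(cmod (det J))\<^sup>2 = r ^ 3" by (simp only: of_real_eq_iff)
  hence "r ^ 3 \<ge> 0" by (metis zero_le_power2)
  hence "r \<ge> 0" by (simp add: zero_le_odd_power)
  thus thesis using that r \<open>c \<noteq> 0\<close> by (metis of_real_0 order_le_less)
qed

end

lemma rank_one_add: "rank_one (v + w) g = rank_one v g + rank_one w g"
  by (rule matrix_eqI)
    (simp add: rank_one_apply matrix_vector_mult_add_rdistrib vec.scale_right_distrib)

section \<open>The real form of the matrix algebra and its conjugation\<close>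

lemma span_matrix_mult:
  fixes S :: "(complex^3^3) set"
  assumes mult: "\<And>A B. A \<in> S \<Longrightarrow> B \<in> S \<Longrightarrow> A ** B \<in> S"
    and "M \<in> span S" "Y \<in> span S"
  shows "M ** Y \<in> span S"
proof -
  have scale_left: "(r *\<^sub>R A) ** B = r *\<^sub>R (A ** B)" for r and A B :: "complex^3^3"
    by (simp only: scaleR_eq_mat_mult matrix_mul_assoc)
  have scale_right: "A ** (r *\<^sub>R B) = r *\<^sub>R (A ** B)" for r and A B :: "complex^3^3"
    by (simp only: scaleR_eq_mat_mult matrix_mul_assoc mat_commutes[of _ A])
  have *: "A ** Y \<in> span S" if A: "A \<in> S" for A
    using assms(3)
  proof (induction rule: span_induct_alt)
    case (step c B C)
    have "A ** B \<in> span S" using mult[OF A step(1)] by (rule span_base)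
    thus ?case
      using step by (simp add: matrix_add_ldistrib scale_right span_add span_scale)
  qed (simp add: span_zero)
  show ?thesis
    using assms(2)
  proof (induction rule: span_induct_alt)
    case (step c B C)
    thus ?case using * by (simp add: matrix_add_rdistrib scale_left span_add span_scale)
  qed (simp add: span_zero)
qed

text \<open>
  If the traces of \<open>S\<close> are real, the real span of \<open>S\<close> is a real form of the full matrix
  algebra, because the trace form is nondegenerate. The complex conjugation with respect to
  this real form is an antilinear ring automorphism.
\<close>

lemma (in unitary_group) conjugation_exists:
  assumes irr: "acts_irreducibly S" and real: "\<And>A. A \<in> S \<Longrightarrow> trace A \<in> \<real>"
  obtains f :: "complex^3^3 \<Rightarrow> complex^3^3"
  where "\<And>M Y. f (M + Y) = f M + f Y" "\<And>M Y. f (M ** Y) = f M ** f Y"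
    "\<And>c. f (mat c) = mat (cnj c)" "\<And>A. A \<in> S \<Longrightarrow> f A = A" "\<And>M. f (f M) = M"
proof -
  define R where "R = span S"
  have R_mult: "M ** Y \<in> R" if "M \<in> R" "Y \<in> R" for M Y
    using span_matrix_mult[of S] mult that R_def by blast
  have R_trace: "trace M \<in> \<real>" if "M \<in> R" for M
    using that unfolding R_def
    by (induction rule: span_induct_alt)
      (simp_all add: trace_0[simplified] trace_add scaleR_eq_mat_mult trace_mat_mult real)
  \<comment> \<open>Multiplied by \<open>Y\<close> in \<open>S\<close> and traced, the relation has
    real part \<open>trace (A ** Y)\<close> and imaginary part \<open>trace (B ** Y)\<close>, so
    both vanish; nondegeneracy then gives \<open>B = 0\<close>.\<close>
  have R_zero: "A = 0 \<and> B = 0" if AB: "A \<in> R" "B \<in> R" "A + mat \<i> ** B = 0" for A B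
  proof -
    have trace_0_on_S: "trace (B ** Y) = 0" if "Y \<in> S" for Y
    proof -
      have Y: "Y \<in> R" using that by (simp add: R_def span_base)
      obtain a where a: "trace (A ** Y) = of_real a"
        using R_trace[OF R_mult[OF AB(1) Y]] by (metis Reals_cases)
      obtain b where b: "trace (B ** Y) = of_real b"
        using R_trace[OF R_mult[OF AB(2) Y]] by (metis Reals_cases)
      have "trace ((A + mat \<i> ** B) ** Y) = of_real a + \<i> * of_real b"
        by (simp add: matrix_add_rdistrib trace_add a trace_mat_mult b flip: matrix_mul_assoc)
      hence "of_real a + \<i> * of_real b = (0 :: complex)"
        using AB(3) trace_0 by (simp add: trace_0[simplified])
      thus ?thesis using b by (simp add: complex_eq_iff)
    qed
    have "trace (B ** Y) = 0" if "Y \<in> cspan S" for Y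
      using that by induction (simp_all add: trace_0_on_S trace_mult_add_right trace_mult_scale_right)
    hence "B = 0" using burnside[OF irr] by (intro trace_form_nondegenerate) blast
    thus ?thesis using AB(3) by simp
  qed
  have R_unique: "A = A' \<and> B = B'"
    if "A \<in> R" "B \<in> R" "A' \<in> R" "B' \<in> R" "A + mat \<i> ** B = A' + mat \<i> ** B'" for A B A' B'
  proof -
    have "(A - A') + mat \<i> ** (B - B') = 0"
    proof (rule matrix_eqI)
      fix v
      show "(A - A' + mat \<i> ** (B - B')) *v v = 0 *v v"
        using arg_cong[OF that(5), of "\<lambda>M. M *v v"]
        by (simp add: mat_vector_mult algebra_simps flip: matrix_vector_mul_assoc)
    qed
    thus ?thesis using R_zero[of "A - A'" "B - B'"] that by (simp add: R_def span_diff)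
  qed
  have "\<exists>A\<in>R. \<exists>B\<in>R. M = A + mat \<i> ** B" if "M \<in> cspan S" for M
    using that
  proof induction
    case (cspan_base M)
    thus ?case
      by (intro bexI[of _ M] bexI[of _ 0]) (simp_all add: R_def span_base span_zero)
  next
    case (cspan_add M Y)
    then obtain A B A' B' where "A \<in> R" "B \<in> R" "M = A + mat \<i> ** B"
      "A' \<in> R" "B' \<in> R" "Y = A' + mat \<i> ** B'" by blast
    thus ?case
      by (intro bexI[of _ "A + A'"] bexI[of _ "B + B'"])
        (simp_all add: R_def span_add matrix_add_ldistrib)
  next
    case (cspan_scale M c)
    then obtain A B where AB: "A \<in> R" "B \<in> R" "M = A + mat \<i> ** B" by blast
    have "c = of_real (Re c) + \<i> * of_real (Im c)" by (rule complex_eq)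
    then obtain a b where c: "c = of_real a + \<i> * of_real b" by blast
    show ?case
    proof (intro bexI)
      show "mat c ** M = (a *\<^sub>R A - b *\<^sub>R B) + mat \<i> ** (b *\<^sub>R A + a *\<^sub>R B)"
        by (rule matrix_eqI)
          (simp add: AB c scaleR_eq_mat_mult mat_vector_mult
            algebra_simps flip: matrix_vector_mul_assoc)
    qed (use AB in \<open>simp_all add: R_def span_add span_diff span_scale\<close>)
  qed
  hence "\<forall>M. \<exists>A B. A \<in> R \<and> B \<in> R \<and> M = A + mat \<i> ** B" using burnside[OF irr] by blast
  then obtain P Q where PQ: "\<And>M. P M \<in> R" "\<And>M. Q M \<in> R" "\<And>M. M = P M + mat \<i> ** Q M"
    by metis
  define f where "f M = P M - mat \<i> ** Q M" for M
  have f: "f (A + mat \<i> ** B) = A - mat \<i> ** B" if "A \<in> R" "B \<in> R" for A B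
    using R_unique[OF that PQ(1,2) PQ(3)] f_def by simp
  have R0: "0 \<in> R" by (simp add: R_def span_zero)
  have R1: "mat 1 \<in> R" by (simp add: R_def span_base one)
  show thesis
  proof (rule that[of f])
    fix M Y
    define A B C D where "A = P M" and "B = Q M" and "C = P Y" and "D = Q Y"
    have R: "A \<in> R" "B \<in> R" "C \<in> R" "D \<in> R" by (simp_all add: A_def B_def C_def D_def PQ)
    have M: "M = A + mat \<i> ** B" and Y: "Y = C + mat \<i> ** D"
      using PQ(3) by (simp_all only: A_def B_def C_def D_def)
    have fM: "f M = A - mat \<i> ** B" and fY: "f Y = C - mat \<i> ** D"
      by (simp_all add: f_def A_def B_def C_def D_def)
    have "M + Y = (A + C) + mat \<i> ** (B + D)"
      by (simp add: M Y matrix_add_ldistrib)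
    hence "f (M + Y) = (A + C) - mat \<i> ** (B + D)"
      using f[of "A + C" "B + D"] R by (simp add: R_def span_add)
    thus "f (M + Y) = f M + f Y"
      by (simp add: fM fY matrix_add_ldistrib)
    have "M ** Y = (A ** C - B ** D) + mat \<i> ** (A ** D + B ** C)"
      by (rule matrix_eqI)
        (simp add: M Y mat_vector_mult vec.scale algebra_simps flip: matrix_vector_mul_assoc)
    hence "f (M ** Y) = (A ** C - B ** D) - mat \<i> ** (A ** D + B ** C)"
      using f[of "A ** C - B ** D" "A ** D + B ** C"] R R_mult by (simp add: R_def span_add span_diff)
    also have "\<dots> = f M ** f Y"
      by (rule matrix_eqI)
        (simp add: fM fY mat_vector_mult vec.scale algebra_simps flip: matrix_vector_mul_assoc)
    finally show "f (M ** Y) = f M ** f Y" .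
    have neg: "mat \<i> ** (- B) = - (mat \<i> ** B)"
      by (simp add: matrix_matrix_mult_def vec_eq_iff sum_negf)
    have "f M = A + mat \<i> ** (- B)" by (simp add: fM neg)
    hence "f (f M) = A - mat \<i> ** (- B)"
      using f[of A "- B"] R by (simp add: R_def span_neg)
    thus "f (f M) = M" by (simp add: M neg)
  next
    fix c
    have "mat c = Re c *\<^sub>R mat 1 + mat \<i> ** (Im c *\<^sub>R (mat 1 :: complex^3^3))"
      by (rule matrix_eqI)
        (simp add: scaleR_eq_mat_mult mat_mult_mat mat_vector_mult matrix_vector_mult_add_rdistrib
          flip: vec.scale_left_distrib complex_eq)
    hence "f (mat c) = Re c *\<^sub>R mat 1 - mat \<i> ** (Im c *\<^sub>R mat 1)"
      using f[of "Re c *\<^sub>R mat 1" "Im c *\<^sub>R mat 1"] R1 by (simp add: R_def span_scale)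
    also have "\<dots> = mat (cnj c)"
    proof (rule matrix_eqI)
      fix v :: "complex^3"
      have "(Re c *\<^sub>R mat 1 - mat \<i> ** (Im c *\<^sub>R mat 1)) *v v
          = of_real (Re c) *s v - (\<i> * of_real (Im c)) *s v"
        by (simp add: scaleR_eq_mat_mult mat_mult_mat mat_vector_mult
            matrix_vector_mult_diff_rdistrib)
      also have "\<dots> = (of_real (Re c) - \<i> * of_real (Im c)) *s v"
        by (simp only: vec.scale_left_diff_distrib)
      also have "of_real (Re c) - \<i> * of_real (Im c) = cnj c" by (simp add: complex_eq_iff)
      finally show "(Re c *\<^sub>R mat 1 - mat \<i> ** (Im c *\<^sub>R mat 1)) *v v = mat (cnj c) *v v"
        by (simp only: mat_vector_mult)
    qed
    finally show "f (mat c) = mat (cnj c)" .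
  next
    fix A assume "A \<in> S"
    hence "A \<in> R" by (simp add: R_def span_base)
    thus "f A = A" using f[OF _ R0, of A] by simp
  qed
qed


text \<open>A concrete Skolem-Noether argument. The matrices \<open>E v\<close> form a minimal left
  ideal, a copy of the space. Applying \<open>f\<close> to this ideal and evaluating at a fixed
  vector \<open>u\<close> gives \<open>j\<close> with \<open>j (M *v v) = f M *v j v\<close>, and
  \<open>f\<close> fixes \<open>S\<close>.\<close>

theorem (in unitary_group) invariant_antilinear_map:
  assumes irr: "acts_irreducibly S" and real: "\<And>A. A \<in> S \<Longrightarrow> trace A \<in> \<real>"
  shows "\<exists>j. antilinear_map j \<and> (\<forall>A\<in>S. \<forall>v. j (A *v v) = A *v j v) \<and> (\<forall>v. j (j v) = v)"
proof -
  obtain f where f_add: "\<And>M Y. f (M + Y) = f M + f Y" and f_mult: "\<And>M Y. f (M ** Y) = f M ** f Y"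
    and f_mat: "\<And>c. f (mat c) = mat (cnj c)" and f_S: "\<And>A. A \<in> S \<Longrightarrow> f A = A"
    and f_f: "\<And>M. f (f M) = M"
    using conjugation_exists[OF irr real] by metis
  define e :: "complex^3" where "e = axis 1 1"
  define E where "E v = rank_one v (axis 3 1)" for v
  have E_e: "E v *v e = v" for v by (simp add: E_def rank_one_apply herm_axis e_def)
  have "f (E e) \<noteq> 0"
  proof
    assume "f (E e) = 0"
    hence "E e = f (mat 0)" using f_f[of "E e"] by simp
    hence "E e = 0" by (simp add: f_mat del: mat_0) simp
    hence "e = 0" using E_e[of e] by simp
    thus False by (simp add: e_def)
  qed
  \<comment> \<open>Any vector not killed by \<open>f (E e)\<close> will do; it guarantees that
    \<open>j\<close> is not zero.\<close>
  then obtain u where u: "f (E e) *v u \<noteq> 0" using matrix_eqI[of "f (E e)" 0] by auto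
  define j where "j v = f (E v) *v u" for v
  have j_mult: "j (M *v v) = f M *v j v" for M v
    by (simp add: j_def E_def matrix_vector_mul_assoc f_mult flip: mult_rank_one)
  have j_add: "j (v + w) = j v + j w" for v w
    by (simp add: j_def E_def rank_one_add f_add matrix_vector_mult_add_rdistrib)
  have j_scale: "j (c *s v) = cnj c *s j v" for c v
    using j_mult[of "mat c" v] by (simp add: mat_vector_mult f_mat)
  interpret j: antilinear_map j by unfold_locales (rule j_add, rule j_scale)
  have j_comm: "j (A *v v) = A *v j v" if "A \<in> S" for A v
    using j_mult f_S[OF that] by simp
  have j_nz: "j v \<noteq> 0" if v: "v \<noteq> 0" for v
  proof
    assume "j v = 0"
    obtain M where "M *v v = e" by (rule cspan_transitive[OF irr v])
    hence "j e = 0" using j_mult[of M v] \<open>j v = 0\<close> by simp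
    thus False using u by (simp add: j_def)
  qed
  have "\<exists>c. \<forall>v. j (j v) = c *s v"
    by (rule commuting_map_is_scalar[OF burnside[OF irr]]) (simp_all add: j_add j_scale j_comm)
  then obtain c where c: "\<And>v. j (j v) = c *s v" by blast
  have "c \<noteq> 0" using c[of e] j_nz[of "j e"] j_nz[of e] by (auto simp: e_def)
  then obtain r where r: "r > 0" "c = of_real r" by (rule j.square_pos[OF c])
  \<comment> \<open>A real factor \<open>s\<close> changes the square of \<open>j\<close> by
    \<open>s * s\<close>, so positivity of \<open>r\<close> allows normalization to 1.\<close>
  define s where "s = complex_of_real (1 / sqrt r)"
  have s: "cnj s = s" "s * s * c = 1"
    using r by (simp_all add: s_def field_simps flip: of_real_mult)
  show ?thesis
  proof (intro exI[of _ "\<lambda>v. s *s j v"] conjI ballI allI)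
    show "antilinear_map (\<lambda>v. s *s j v)"
      by unfold_locales (simp_all add: j_add j_scale vec.scale_right_distrib mult.commute)
    show "s *s j (A *v v) = A *v (s *s j v)" if "A \<in> S" for A v
      by (simp add: j_comm[OF that] vec.scale)
    show "s *s j (s *s j v) = v" for v
      using s by (simp add: j_scale c mult.assoc)
  qed
qed

text \<open>The form sending \<open>v\<close>, \<open>w\<close> to \<open>herm (j w) (j v)\<close>
  is again sesquilinear and \<open>S\<close>-invariant, so by Schur's lemma it is \<mu> times
  \<open>herm\<close>. Comparing determinants gives \<open>\<mu> ^ 3 = 1\<close>, and \<mu> is a
  quotient of two real norms.\<close>

lemma (in unitary_group) form_conjugate:
  assumes irr: "acts_irreducibly S" and "antilinear_map j"
    and comm: "\<And>A v. A \<in> S \<Longrightarrow> j (A *v v) = A *v j v" and inv: "\<And>v. j (j v) = v"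
  shows "herm (j v) (j w) = herm w v"
proof -
  interpret antilinear_map j by fact
  \<comment> \<open>The vector representing the transformed form through \<open>herm\<close>; its
    coordinates are the values on the standard basis in reverse order.\<close>
  define T :: "complex^3 \<Rightarrow> complex^3" where
    "T v = vector [herm (j (axis 3 1)) (j v), herm (j (axis 2 1)) (j v), herm (j (axis 1 1)) (j v)]"
    for v
  have T: "herm (T v) w = herm (j w) (j v)" for v w
    unfolding j_expansion[of w]
    by (simp add: T_def herm_def[of _ w] herm_simps mult.commute)
  have "\<exists>\<mu>. \<forall>v. T v = \<mu> *s v"
  proof (rule commuting_map_is_scalar[OF burnside[OF irr]])
    fix v w c A
    show "T (v + w) = T v + T w"
      by (rule herm_right_eqI) (simp add: T herm_simps j_add)
    show "T (c *s v) = c *s T v"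
      by (rule herm_right_eqI) (simp add: T herm_simps j_scale)
    assume A: "A \<in> S"
    obtain B where B: "B \<in> S" "A ** B = mat 1" using inverse A by blast
    show "T (A *v v) = A *v T v"
    proof (rule herm_right_eqI)
      fix w
      have w: "w = A *v (B *v w)" using B by (simp add: matrix_vector_mul_assoc)
      have "herm (T (A *v v)) (A *v (B *v w)) = herm (A *v T v) (A *v (B *v w))"
        by (simp add: T comm[OF A] herm_invariant[OF A])
      thus "herm (T (A *v v)) w = herm (A *v T v) w" using w by simp
    qed
  qed
  then obtain \<mu> where \<mu>: "\<And>v. T v = \<mu> *s v" by blast
  have scaled: "herm (j w) (j v) = \<mu> * herm v w" for v w
    using T[of v w] by (simp add: \<mu> herm_scale_left)
  have "herm (J *v z) (J *v w) = \<mu> * herm z w" for z w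
    by (simp add: J_apply scaled herm_vconj)
  hence "det J * cnj (det J) = \<mu> ^ 3" by (rule det_of_form_scaling)
  moreover have "det J * cnj (det J) = 1"
    using det_J_of_square[of 1] inv by simp
  ultimately have cube: "\<mu> ^ 3 = 1" by simp
  define z :: "complex^3" where "z = vector [1, 0, -1]"
  have "herm z z = -2" by (simp add: z_def herm_def)
  hence "herm (j z) (j z) = of_real (-2) * \<mu>" using scaled[of z z] by simp
  hence "\<mu> = herm (j z) (j z) / of_real (-2)" by simp
  hence "\<mu> \<in> \<real>" using herm_self_real[of "j z"] by (metis Reals_divide Reals_of_real)
  then obtain m where m: "\<mu> = of_real m" by (metis Reals_cases)
  have "m ^ 3 = 1" using cube unfolding m of_real_power[symmetric] by (simp only: of_real_eq_1_iff)
  moreover from this have "m \<ge> 0" using zero_le_odd_power[of 3 m] by simp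
  ultimately have "m = 1" using power_eq_imp_eq_base[of m 3 1] by simp
  thus ?thesis using scaled m by simp
qed

section \<open>Real forms of signature (2,1)\<close>

text \<open>A direct proof of this consequence of signature (2,1): subtract a multiple of
  \<open>v\<close> from \<open>w\<close> to kill the third coordinate. On vectors with third
  coordinate 0 the form is the squared modulus of the second one.\<close>

lemma orthogonal_to_negative_positive:
  assumes v: "Re (herm v v) < 0" and wv: "herm w v = 0" and w: "w \<noteq> 0"
  shows "Re (herm w w) > 0"
proof -
  have v3: "v $ 3 \<noteq> 0"
  proof
    assume "v $ 3 = 0"
    hence "herm v v = of_real ((cmod (v $ 2))\<^sup>2)"
      unfolding complex_norm_square by (simp add: herm_def)
    thus False using v by simp
  qed
  define c where "c = w $ 3 / v $ 3"
  define u where "u = w - c *s v"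
  have "u $ 3 = 0" using v3 by (simp add: u_def c_def)
  hence "herm u u = of_real ((cmod (u $ 2))\<^sup>2)"
    unfolding complex_norm_square by (simp add: herm_def)
  moreover have "herm v w = 0" using wv herm_eq0_sym by blast
  hence "herm u u = herm w w + of_real ((cmod c)\<^sup>2) * herm v v"
    unfolding complex_norm_square u_def using wv by (simp add: herm_simps)
  ultimately have eq: "Re (herm w w) = (cmod (u $ 2))\<^sup>2 + (cmod c)\<^sup>2 * (- Re (herm v v))"
    by (simp add: complex_eq_iff)
  have "u $ 2 \<noteq> 0 \<or> c \<noteq> 0"
  proof (rule ccontr)
    assume "\<not> ?thesis"
    hence "u $ 2 = 0" "c = 0" by auto
    hence w23: "w $ 2 = 0" "w $ 3 = 0" using v3 by (auto simp: u_def c_def)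
    hence "w $ 1 = 0" using wv v3 by (simp add: herm_def)
    thus False using w w23 by (simp add: vec_eq_iff forall_3)
  qed
  hence "(cmod (u $ 2))\<^sup>2 > 0 \<or> (cmod c)\<^sup>2 * (- Re (herm v v)) > 0"
    using v by (auto intro!: mult_pos_neg)
  moreover have "(cmod (u $ 2))\<^sup>2 \<ge> 0" "(cmod c)\<^sup>2 * (- Re (herm v v)) \<ge> 0"
    using v by (simp, intro mult_nonneg_nonneg) auto
  ultimately show ?thesis unfolding eq by linarith
qed

lemma matrix_of_basis:
  fixes f1 f2 f3 :: "complex^3"
  shows "\<exists>M :: complex^3^3. \<forall>z. M *v z = z $ 1 *s f1 + z $ 2 *s f2 + z $ 3 *s f3"
proof (intro exI allI)
  show "(rank_one f1 (axis 3 1) + rank_one f2 (axis 2 1) + rank_one f3 (axis 1 1)) *v z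
      = z $ 1 *s f1 + z $ 2 *s f2 + z $ 3 *s f3" for z
    by (simp add: matrix_vector_mult_add_rdistrib rank_one_apply herm_axis)
qed

locale real_structure = antilinear_map +
  assumes j_j: "j (j v) = v"
    and herm_j: "herm (j v) (j w) = herm w v"
begin

lemma fixed_scale: "j x = x \<Longrightarrow> j (of_real r *s x) = of_real r *s x"
  by (simp add: j_scale)

lemma fixed_herm_real:
  assumes "j x = x" "j y = y"
  obtains r where "herm x y = of_real r"
proof -
  have "cnj (herm x y) = herm x y" using herm_j[of x y] assms by (simp add: herm_cnj)
  thus thesis using that by (metis Reals_cases Reals_cnj_iff)
qed

lemma fixed_decomposition:
  obtains x y where "j x = x" "j y = y" "z = x + \<i> *s y"
proof
  show "j ((1/2) *s (z + j z)) = (1/2) *s (z + j z)"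
    by (simp add: j_scale j_add j_j add.commute)
  show "j ((- \<i>/2) *s (z - j z)) = (- \<i>/2) *s (z - j z)"
    by (simp add: vec_eq_iff j_scale j_diff j_j algebra_simps)
  show "z = (1/2) *s (z + j z) + \<i> *s ((- \<i>/2) *s (z - j z))"
    by (simp add: vec_eq_iff field_simps)
qed

lemma fixed_not_orthogonal:
  assumes "n \<noteq> 0"
  shows "\<exists>x. j x = x \<and> herm x n \<noteq> 0"
proof (rule ccontr)
  assume "\<not> ?thesis"
  hence *: "herm x n = 0" if "j x = x" for x using that by blast
  have "herm z n = 0" for z
  proof -
    obtain x y where "j x = x" "j y = y" "z = x + \<i> *s y" by (rule fixed_decomposition)
    thus ?thesis using * by (simp add: herm_simps)
  qed
  thus False using assms herm_nondegenerate[of n] herm_eq0_sym by blast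
qed

lemma fixed_normalize:
  assumes x: "j x = x" and q: "Re (herm x x) \<noteq> 0"
  obtains r where "r \<noteq> 0" "j (of_real r *s x) = of_real r *s x"
    "herm (of_real r *s x) (of_real r *s x) = of_real (sgn (Re (herm x x)))"
proof
  define s where "s = 1 / sqrt \<bar>Re (herm x x)\<bar>"
  show "s \<noteq> 0" using q by (simp add: s_def)
  show "j (of_real s *s x) = of_real s *s x" by (rule fixed_scale[OF x])
  have "s * s * Re (herm x x) = sgn (Re (herm x x))"
    using q by (simp add: s_def sgn_if)
  hence "of_real (s * s * Re (herm x x)) = (of_real (sgn (Re (herm x x))) :: complex)" by simp
  thus "herm (of_real s *s x) (of_real s *s x) = of_real (sgn (Re (herm x x)))"
    using herm_self_Re[of x] by (simp add: herm_simps mult.assoc)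
qed

text \<open>The form is symmetric on fixed vectors, so the cross terms cancel and the norm of
  \<open>z\<close> is the sum of the norms of its real and imaginary parts. One of them must be
  negative.\<close>

lemma fixed_negative:
  obtains v where "j v = v" "herm v v = -1"
proof -
  define z :: "complex^3" where "z = vector [1, 0, -1]"
  obtain x y where xy: "j x = x" "j y = y" "z = x + \<i> *s y" by (rule fixed_decomposition)
  have "herm y x = herm x y" using herm_j[of x y] xy by simp
  hence "herm z z = herm x x + herm y y" using xy(3) by (simp add: herm_simps algebra_simps)
  moreover have "herm z z = -2" by (simp add: z_def herm_def)
  ultimately have "Re (herm x x) + Re (herm y y) = -2" by (metis plus_complex.simps(1) Re_complex_of_real of_real_minus of_real_numeral)
  hence "Re (herm x x) < 0 \<or> Re (herm y y) < 0" by linarith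
  then obtain v where v: "j v = v" "Re (herm v v) < 0" using xy by blast
  then obtain r where "j (of_real r *s v) = of_real r *s v"
      "herm (of_real r *s v) (of_real r *s v) = of_real (sgn (Re (herm v v)))"
    using fixed_normalize[of v] by force
  thus thesis using that[of "of_real r *s v"] v by simp
qed

text \<open>One normalization step of Gram-Schmidt. The vector \<open>n\<close> certifies
  independence from the vectors already chosen, and the last conclusion keeps the orthogonality
  relations of \<open>x\<close>.\<close>

lemma fixed_positive:
  assumes v: "herm v v = -1" and x: "j x = x" "herm x v = 0" "herm x n \<noteq> 0"
  obtains a where "j a = a" "herm a a = 1" "herm a n \<noteq> 0" "\<And>u. herm x u = 0 \<Longrightarrow> herm a u = 0"
proof -
  have "x \<noteq> 0" using x by auto
  hence pos: "Re (herm x x) > 0" using orthogonal_to_negative_positive[of v x] v x by simp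
  then obtain r where r: "r \<noteq> 0" "j (of_real r *s x) = of_real r *s x"
      "herm (of_real r *s x) (of_real r *s x) = of_real (sgn (Re (herm x x)))"
    using fixed_normalize[OF x(1)] by force
  show thesis
  proof (rule that[of "of_real r *s x"])
    show "herm (of_real r *s x) (of_real r *s x) = 1" using r pos by simp
  qed (use r x in \<open>simp_all add: herm_scale_left\<close>)
qed

text \<open>
  Gram--Schmidt orthonormalization of the real form of \<open>j\<close>, on which the Hermitian form is
  real of signature (2,1), gives real vectors \<open>v\<close>, \<open>a\<close>, \<open>b\<close> of norms -1, 1, 1; then
  \<open>(a + v) / 2\<close>, \<open>b\<close>, \<open>a - v\<close> have the Gram matrix of the standard basis.
\<close>

theorem standard_form:
  "\<exists>M\<in>carrier U21. \<forall>z. j (M *v z) = M *v vconj z"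
proof -
  obtain v where v: "j v = v" "herm v v = -1" by (rule fixed_negative)
  obtain n where n: "n \<noteq> 0" "herm v n = 0" by (rule orthogonal_vector_exists)
  obtain x where x: "j x = x" "herm x n \<noteq> 0" using fixed_not_orthogonal[OF n(1)] by blast
  obtain r where r: "herm x v = of_real r" by (rule fixed_herm_real[OF x(1) v(1)])
  \<comment> \<open>The projection is added, not subtracted, because \<open>v\<close> has norm -1.
    As \<open>n\<close> is orthogonal to \<open>v\<close>, pairing with it shows that the result is
    not zero.\<close>
  obtain a where a: "j a = a" "herm a a = 1" "herm a v = 0"
  proof (rule fixed_positive[OF v(2), of "x + herm x v *s v" n])
    show "j (x + herm x v *s v) = x + herm x v *s v" using x v r by (simp add: j_add j_scale)
    show v0: "herm (x + herm x v *s v) v = 0" using v by (simp add: herm_simps)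
    show "herm (x + herm x v *s v) n \<noteq> 0" using x n by (simp add: herm_simps)
    fix a assume "j a = a" "herm a a = 1" "\<And>u. herm (x + herm x v *s v) u = 0 \<Longrightarrow> herm a u = 0"
    thus thesis using that v0 by blast
  qed
  have va: "herm v a = 0" using a(3) herm_eq0_sym by blast
  have m: "hcross v a \<noteq> 0"
  proof
    assume "hcross v a = 0"
    moreover have "v \<noteq> 0" using v by auto
    ultimately obtain c where "a = c *s v" using hcross_eq_0_imp by blast
    hence "herm a a = 0" using va by (simp add: herm_scale_left)
    thus False using a by simp
  qed
  \<comment> \<open>A nonzero pairing with the cross product puts \<open>y\<close> outside the plane
    of \<open>v\<close> and \<open>a\<close>.\<close>
  obtain y where y: "j y = y" "herm y (hcross v a) \<noteq> 0" using fixed_not_orthogonal[OF m] by blast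
  obtain p where p: "herm y v = of_real p" by (rule fixed_herm_real[OF y(1) v(1)])
  obtain q where q: "herm y a = of_real q" by (rule fixed_herm_real[OF y(1) a(1)])
  define b0 where "b0 = y + herm y v *s v - herm y a *s a"
  obtain b where b: "j b = b" "herm b b = 1" "herm b v = 0" "herm b a = 0"
  proof (rule fixed_positive[OF v(2), of b0 "hcross v a"])
    show "j b0 = b0" using y v a p q by (simp add: b0_def j_add j_diff j_scale)
    show bv: "herm b0 v = 0" using v a by (simp add: b0_def herm_simps)
    have ba: "herm b0 a = 0" using a va by (simp add: b0_def herm_simps)
    show "herm b0 (hcross v a) \<noteq> 0" using y by (simp add: b0_def herm_simps)
    fix b assume "j b = b" "herm b b = 1" "\<And>u. herm b0 u = 0 \<Longrightarrow> herm b u = 0"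
    thus thesis using that bv ba by blast
  qed
  have vb: "herm v b = 0" and ab: "herm a b = 0" using b herm_eq0_sym by blast+
  note gram = v(2) a(2,3) va b(2-4) vb ab
  obtain M :: "complex^3^3" where M: "\<And>z. M *v z = z $ 1 *s ((1/2) *s (a + v)) + z $ 2 *s b + z $ 3 *s (a - v)"
    using matrix_of_basis[of "(1/2) *s (a + v)" b "a - v"] by blast
  show ?thesis
  proof (intro bexI[of _ M] allI)
    show "j (M *v z) = M *v vconj z" for z
      unfolding M by (simp add: j_add j_scale j_diff v a b vconj_def)
    have "herm (M *v z) (M *v w) = herm z w" for z w
      unfolding M by (simp add: herm_simps gram herm_def[of z w] algebra_simps)
    thus "M \<in> carrier U21" by (simp add: U21_def)
  qed
qed

end

section \<open>Lifting subgroups of PU(2,1) to SU(2,1)\<close>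

lemma mult_U21: "A \<otimes>\<^bsub>U21\<^esub> B = A ** B"
  and one_SU21: "\<one>\<^bsub>SU21\<^esub> = mat 1" and mult_SU21: "A \<otimes>\<^bsub>SU21\<^esub> B = A ** B"
  by (simp_all add: U21_def SU21_def)

lemma pu_class_mult:
  assumes "A \<in> carrier U21" "B \<in> carrier U21"
  shows "pu_class A \<otimes>\<^bsub>PU21\<^esub> pu_class B = pu_class (A ** B)"
  using normal.rcos_sum[OF normal_scalars assms]
  by (simp add: PU21_def FactGroup_def pu_class_def mult_U21)

lemma pu_class_scalar:
  assumes "cmod c = 1"
  shows "pu_class (mat c) = \<one>\<^bsub>PU21\<^esub>"
proof -
  interpret group U21 by (rule group_U21)
  have "mat c \<in> scalars" using assms by (auto simp: scalars_def)
  hence "pu_class (mat c) = scalars"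
    unfolding pu_class_def
    using coset_join2[of "mat c" scalars] scalars_subset normal_scalars normal_imp_subgroup by blast
  thus ?thesis by (simp add: PU21_def FactGroup_def)
qed

lemma SU21_lift:
  assumes "g \<in> carrier PU21"
  obtains A where "A \<in> carrier SU21" "g = pu_class A"
proof -
  obtain A where A: "A \<in> carrier U21" "g = pu_class A" using assms carrier_PU21 by blast
  have "det A * cnj (det A) = 1" using det_of_form_scaling[of A 1] U21_herm[OF A(1)] by simp
  hence "cmod (det A) = 1"
    by (metis complex_mod_sqrt_Re_mult_cnj one_complex.sel(1) real_sqrt_one)
  then obtain t where t: "det A = cis t" by (metis rcis_cmod_Arg rcis_def of_real_1 mult_1)
  \<comment> \<open>A cube root of the inverse determinant, since a scalar matrix contributes its
    cube to the determinant.\<close>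
  define c where "c = cis (- t / 3)"
  have c: "cmod c = 1" by (simp add: c_def)
  have scalar: "mat c \<in> carrier U21" using c scalars_subset by (auto simp: scalars_def)
  have "det (mat c :: complex^3^3) = cis (- t)"
    by (simp add: det_3 mat_def c_def cis_mult)
  hence "det (mat c ** A) = 1" by (simp add: det_mul t cis_mult)
  moreover have "mat c ** A \<in> carrier U21"
    using scalar A(1) by (simp add: U21_def flip: matrix_vector_mul_assoc)
  ultimately have "mat c ** A \<in> carrier SU21" by (simp add: SU21_def)
  moreover have "pu_class (mat c ** A) = g"
  proof -
    interpret group PU21 by (rule group_PU21)
    have "pu_class (mat c ** A) = \<one>\<^bsub>PU21\<^esub> \<otimes>\<^bsub>PU21\<^esub> g"
      using pu_class_mult[OF scalar A(1)] pu_class_scalar[OF c] A(2) by simp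
    thus ?thesis using assms by simp
  qed
  ultimately show thesis using that by blast
qed

lemma unitary_group_of_subgroup:
  assumes "subgroup H SU21"
  shows "unitary_group H"
proof
  interpret subgroup H SU21 by fact
  interpret SU: group SU21 by (rule group_SU21)
  show "H \<subseteq> carrier U21" using subset SU21_in_U21 by blast
  show "mat 1 \<in> H" using one_closed by (simp add: one_SU21)
  show "A ** B \<in> H" if "A \<in> H" "B \<in> H" for A B
    using m_closed[OF that] by (simp add: mult_SU21)
  show "\<exists>B\<in>H. A ** B = mat 1 \<and> B ** A = mat 1" if "A \<in> H" for A
    using that m_inv_closed SU.l_inv SU.r_inv mem_carrier
    by (intro bexI[of _ "inv\<^bsub>SU21\<^esub> A"]) (simp_all add: one_SU21 flip: mult_SU21)
qed

lemma cube_SU21: "A [^]\<^bsub>SU21\<^esub> (3::nat) = A ** A ** A"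
  by (simp add: numeral_3_eq_3 nat_pow_def mult_SU21 one_SU21)

context
  fixes G :: "(complex^3^3) set set"
  assumes G: "subgroup G PU21"
begin

lemma subgroup_preimage: "subgroup (SU21_preimage G) SU21"
proof (rule group.subgroupI[OF group_SU21])
  interpret G: subgroup G PU21 by (rule G)
  interpret PU: group PU21 by (rule group_PU21)
  interpret SU: group SU21 by (rule group_SU21)
  show "SU21_preimage G \<subseteq> carrier SU21" by (auto simp: SU21_preimage_def)
  have "mat 1 \<in> carrier SU21" using SU.one_closed by (simp add: one_SU21)
  hence "mat 1 \<in> SU21_preimage G"
    using pu_class_scalar[of 1] G.one_closed by (simp add: SU21_preimage_def)
  thus "SU21_preimage G \<noteq> {}" by blast
  fix A assume "A \<in> SU21_preimage G"
  hence A: "A \<in> carrier SU21" "pu_class A \<in> G" by (auto simp: SU21_preimage_def)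
  {
    fix B assume "B \<in> SU21_preimage G"
    hence B: "B \<in> carrier SU21" "pu_class B \<in> G" by (auto simp: SU21_preimage_def)
    have "pu_class (A ** B) \<in> G"
      using G.m_closed[OF A(2) B(2)] pu_class_mult A B SU21_in_U21 by simp
    thus "A \<otimes>\<^bsub>SU21\<^esub> B \<in> SU21_preimage G"
      using SU.m_closed[OF A(1) B(1)] by (simp add: SU21_preimage_def mult_SU21)
  }
  let ?B = "inv\<^bsub>SU21\<^esub> A"
  have B: "?B \<in> carrier SU21" using A by simp
  have "?B ** A = mat 1" using SU.l_inv[OF A(1)] by (simp add: mult_SU21 one_SU21)
  hence "pu_class ?B \<otimes>\<^bsub>PU21\<^esub> pu_class A = \<one>\<^bsub>PU21\<^esub>"
    using pu_class_mult[of ?B A] pu_class_scalar[of 1] A B SU21_in_U21 by simp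
  moreover have "pu_class ?B \<in> carrier PU21" using B SU21_in_U21 carrier_PU21 by blast
  ultimately have "inv\<^bsub>PU21\<^esub> (pu_class A) = pu_class ?B"
    using PU.inv_equality G.mem_carrier[OF A(2)] by blast
  thus "?B \<in> SU21_preimage G"
    using G.m_inv_closed[OF A(2)] B by (simp add: SU21_preimage_def)
qed

lemma subgroup_cubes: "subgroup (cube_subgroup (SU21_preimage G)) SU21"
  and cubes_subset: "cube_subgroup (SU21_preimage G) \<subseteq> SU21_preimage G"
proof -
  interpret SU: group SU21 by (rule group_SU21)
  interpret P: subgroup "SU21_preimage G" SU21 by (rule subgroup_preimage)
  let ?C = "{A [^]\<^bsub>SU21\<^esub> (3::nat) | A. A \<in> SU21_preimage G}"
  have C: "?C \<subseteq> SU21_preimage G"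
    using P.m_closed by (auto simp: cube_SU21 simp flip: mult_SU21)
  thus "cube_subgroup (SU21_preimage G) \<subseteq> SU21_preimage G"
    unfolding cube_subgroup_def by (rule SU.generate_subgroup_incl[OF _ subgroup_preimage])
  show "subgroup (cube_subgroup (SU21_preimage G)) SU21"
    unfolding cube_subgroup_def using C P.subset by (intro SU.generate_is_subgroup) blast
qed

text \<open>The conjugate of a cube is the cube of the conjugate, and the inverse of a cube is a
  cube.\<close>

lemma normal_pair_cubes: "normal_pair (SU21_preimage G) (cube_subgroup (SU21_preimage G))"
proof -
  interpret SU: group SU21 by (rule group_SU21)
  interpret P: subgroup "SU21_preimage G" SU21 by (rule subgroup_preimage)
  interpret S: unitary_group "SU21_preimage G"
    by (rule unitary_group_of_subgroup[OF subgroup_preimage])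
  interpret N: unitary_group "cube_subgroup (SU21_preimage G)"
    by (rule unitary_group_of_subgroup[OF subgroup_cubes])
  show ?thesis
  proof
    show "cube_subgroup (SU21_preimage G) \<subseteq> SU21_preimage G" by (rule cubes_subset)
    fix A B n assume A: "A \<in> SU21_preimage G" and B: "B \<in> SU21_preimage G" and AB: "A ** B = mat 1"
      and n: "n \<in> cube_subgroup (SU21_preimage G)"
    have BA: "B ** A = mat 1" using AB by (simp add: matrix_left_right_inverse)
    have conj_mult: "(A ** M ** B) ** (A ** Y ** B) = A ** (M ** Y) ** B" for M Y
      using BA by (metis matrix_mul_assoc matrix_mul_rid)
    have conj_cube: "A ** (C [^]\<^bsub>SU21\<^esub> (3::nat)) ** B \<in> cube_subgroup (SU21_preimage G)"
      if "C \<in> SU21_preimage G" for C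
    proof -
      have "A ** C ** B \<in> SU21_preimage G" using A B that by (intro S.mult)
      moreover have "A ** (C [^]\<^bsub>SU21\<^esub> (3::nat)) ** B = (A ** C ** B) [^]\<^bsub>SU21\<^esub> (3::nat)"
        by (simp add: cube_SU21 conj_mult)
      ultimately show ?thesis unfolding cube_subgroup_def by (blast intro: generate.incl)
    qed
    have "n \<in> generate SU21 {A [^]\<^bsub>SU21\<^esub> (3::nat) | A. A \<in> SU21_preimage G}"
      using n unfolding cube_subgroup_def .
    thus "A ** n ** B \<in> cube_subgroup (SU21_preimage G)"
    proof (induction rule: generate.induct)
      case one
      show ?case using N.one AB by (simp add: one_SU21)
    next
      case (incl h)
      thus ?case using conj_cube by blast
    next
      case (inv h)
      then obtain C where C: "C \<in> SU21_preimage G" "h = C [^]\<^bsub>SU21\<^esub> (3::nat)" by blast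
      hence "inv\<^bsub>SU21\<^esub> h = (inv\<^bsub>SU21\<^esub> C) [^]\<^bsub>SU21\<^esub> (3::nat)"
        using SU.nat_pow_inv[of C 3] P.mem_carrier by simp
      thus ?case using conj_cube[of "inv\<^bsub>SU21\<^esub> C"] P.m_inv_closed[OF C(1)] by simp
    next
      case (eng h k)
      thus ?case using N.mult[OF eng(3,4)] by (simp add: conj_mult mult_SU21)
    qed
  qed
qed

lemma cube_traces_real:
  assumes "invariant_trace_field G \<subseteq> \<real>" "n \<in> cube_subgroup (SU21_preimage G)"
  shows "trace n \<in> \<real>"
  using assms generate_field.incl[of "trace n"]
  unfolding invariant_trace_field_def trace_field_def by blast

text \<open>Turns non-elementarity into a statement about matrices of determinant 1; the hypothesis
  on \<open>v\<close> covers interior and boundary points together.\<close>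

lemma orbit_infinite:
  assumes "\<not> elementary G" and v: "v \<noteq> 0" "Re (herm v v) \<le> 0"
  shows "infinite {proj (A *v v) | A. A \<in> SU21_preimage G}"
proof -
  interpret G: subgroup G PU21 by (rule G)
  have "{act g (proj v) | g. g \<in> G} \<subseteq> {proj (A *v v) | A. A \<in> SU21_preimage G}"
  proof
    fix p assume "p \<in> {act g (proj v) | g. g \<in> G}"
    then obtain g where g: "g \<in> G" "p = act g (proj v)" by blast
    obtain A where "A \<in> carrier SU21" "g = pu_class A" using SU21_lift G.mem_carrier g(1) by metis
    thus "p \<in> {proj (A *v v) | A. A \<in> SU21_preimage G}"
      using g by (auto simp: act_pu_class SU21_preimage_def)
  qed
  moreover have "proj v \<in> H2C \<union> boundary_H2C"
  proof (cases "Re (herm v v) = 0")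
    case True
    hence "herm v v = 0" using herm_self_Re[of v] by simp
    thus ?thesis using v by (auto simp: boundary_H2C_def)
  next
    case False
    thus ?thesis using v by (auto simp: H2C_def)
  qed
  hence "infinite {act g (proj v) | g. g \<in> G}" using assms(1) unfolding elementary_def by blast
  ultimately show ?thesis using finite_subset by blast
qed

text \<open>One inclusion for all elements suffices, since it also applies to inverses.\<close>

lemma leaves_invariantI:
  assumes P: "\<And>p. p \<in> P \<Longrightarrow> \<exists>v. p = proj v"
    and inv: "\<And>A v. A \<in> SU21_preimage G \<Longrightarrow> proj v \<in> P \<Longrightarrow> proj (A *v v) \<in> P"
  shows "leaves_invariant G P"
  unfolding leaves_invariant_def
proof
  interpret G: subgroup G PU21 by (rule G)
  interpret S: unitary_group "SU21_preimage G"
    by (rule unitary_group_of_subgroup[OF subgroup_preimage])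
  fix g assume "g \<in> G"
  then obtain A where "A \<in> carrier SU21" and g: "g = pu_class A"
    using SU21_lift G.mem_carrier by metis
  hence A: "A \<in> SU21_preimage G" using \<open>g \<in> G\<close> by (simp add: SU21_preimage_def)
  obtain B where B: "B \<in> SU21_preimage G" "A ** B = mat 1" using S.inverse[OF A] by blast
  show "act g ` P = P"
  proof
    show "act g ` P \<subseteq> P"
    proof
      fix q assume "q \<in> act g ` P"
      then obtain p where p: "p \<in> P" "q = act g p" by blast
      obtain v where "p = proj v" using P[OF p(1)] by blast
      thus "q \<in> P" using p inv[OF A] by (simp add: g act_pu_class)
    qed
    show "P \<subseteq> act g ` P"
    proof
      fix p assume p: "p \<in> P"
      then obtain v where v: "p = proj v" using P by blast
      have "act g (proj (B *v v)) = p"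
        using B v by (simp add: g act_pu_class matrix_vector_mul_assoc)
      moreover have "proj (B *v v) \<in> P" using inv[OF B(1)] p v by simp
      ultimately show "p \<in> act g ` P" by blast
    qed
  qed
qed

end

section \<open>The three cases\<close>

lemma proj_eqE:
  assumes "proj v = proj w"
  obtains c where "c \<noteq> 0" "v = c *s w"
proof -
  have "v = 1 *s v" by simp
  hence "v \<in> proj v" unfolding proj_def by (intro CollectI exI[of _ 1]) simp
  hence "v \<in> proj w" using assms by simp
  thus thesis using that by (auto simp: proj_def)
qed

lemma proj_in_H2C_iff: "proj v \<in> H2C \<longleftrightarrow> Re (herm v v) < 0"
proof
  assume "proj v \<in> H2C"
  then obtain w where w: "proj v = proj w" "Re (herm w w) < 0" by (auto simp: H2C_def)
  then obtain c where c: "c \<noteq> 0" "v = c *s w" by (elim proj_eqE)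
  hence "herm v v = of_real ((cmod c)\<^sup>2) * herm w w"
    unfolding complex_norm_square by (simp add: herm_scale)
  hence "Re (herm v v) = (cmod c)\<^sup>2 * Re (herm w w)" by simp
  thus "Re (herm v v) < 0" using w(2) c(1) by (simp add: mult_pos_neg)
qed (auto simp: H2C_def)

lemma complex_geodesic_orthogonal:
  assumes v: "Re (herm v v) > 0"
  shows "complex_geodesic ({proj w | w. w \<in> {w. herm w v = 0} \<and> w \<noteq> 0} \<inter> H2C)"
proof -
  define W where "W = {w. herm w v = 0}"
  have W: "vec.subspace W" by (simp add: W_def vec.subspace_def herm_simps)
  have nz: "herm v v \<noteq> 0" using v by auto
  define p where "p z = z - (herm z v / herm v v) *s v" for z
  have pW: "p z \<in> W" for z using nz by (simp add: p_def W_def herm_simps)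
  have "z \<in> vec.span (insert v W)" for z
    unfolding vec.span_breakdown_eq using pW[of z] unfolding p_def by (blast intro: vec.span_base)
  hence "vec.span (insert v W) = UNIV" by blast
  hence "vec.dim (insert v W) = vec.dim (UNIV :: (complex^3) set)" by (metis vec.dim_span)
  hence "vec.dim (insert v W) = 3" by (simp only: vec_dim_card) simp
  moreover have "v \<notin> vec.span W" using W nz by (simp add: vec.span_eq_iff[THEN iffD2] W_def)
  ultimately have "vec.dim W = 2" by (simp add: vec.dim_insert)
  hence "projective_line {proj w | w. w \<in> W \<and> w \<noteq> 0}"
    unfolding projective_line_def using W by blast
  moreover have "{proj w | w. w \<in> W \<and> w \<noteq> 0} \<inter> H2C \<noteq> {}"
  proof -
    \<comment> \<open>Projecting a negative vector along the positive vector \<open>v\<close> only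
      lowers its norm, so the complement contains negative vectors.\<close>
    define z :: "complex^3" where "z = vector [1, 0, -1]"
    have zz: "herm z z = -2" by (simp add: z_def herm_def)
    obtain q where q: "herm v v = of_real q" "q > 0" using herm_self_Re[of v] v by metis
    have "herm (p z) v = 0" using pW[of z] by (simp add: W_def)
    hence "herm (p z) (p z) = herm (p z) z" unfolding p_def[of z] by (simp add: herm_simps)
    also have "\<dots> = herm z z - herm z v * cnj (herm z v) / of_real q"
      by (simp add: p_def herm_simps q herm_cnj)
    also have "\<dots> = of_real (- 2 - (cmod (herm z v))\<^sup>2 / q)"
      by (simp add: zz complex_norm_square del: of_real_power)
    finally have "Re (herm (p z) (p z)) = - 2 - (cmod (herm z v))\<^sup>2 / q"
      by (simp only: Re_complex_of_real)
    moreover have "(cmod (herm z v))\<^sup>2 / q \<ge> 0" using q(2) by simp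
    ultimately have "Re (herm (p z) (p z)) < 0" by linarith
    moreover from this have "p z \<noteq> 0" by auto
    ultimately have "proj (p z) \<in> {proj w | w. w \<in> W \<and> w \<noteq> 0} \<inter> H2C"
      using pW[of z] by (auto simp: proj_in_H2C_iff)
    thus ?thesis by blast
  qed
  ultimately show ?thesis unfolding complex_geodesic_def W_def by blast
qed

lemma C_Fuchsian_of_reducible:
  assumes G: "discrete_subgroup G" "\<not> elementary G"
    and red: "\<not> acts_irreducibly (SU21_preimage G)"
  shows "C_Fuchsian G"
proof -
  have sub: "subgroup G PU21" using G by (simp add: discrete_subgroup_def)
  interpret S: unitary_group "SU21_preimage G"
    by (rule unitary_group_of_subgroup[OF subgroup_preimage[OF sub]])
  obtain v where v: "v \<noteq> 0" "\<And>A. A \<in> SU21_preimage G \<Longrightarrow> \<exists>c. A *v v = c *s v"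
    by (rule S.invariant_line[OF red]) blast
  have pos: "Re (herm v v) > 0"
  proof (rule ccontr)
    assume "\<not> ?thesis"
    hence inf: "infinite {proj (A *v v) | A. A \<in> SU21_preimage G}"
      using orbit_infinite[OF sub G(2) v(1)] by simp
    have "proj (A *v v) = proj v" if A: "A \<in> SU21_preimage G" for A
    proof -
      obtain c where c: "A *v v = c *s v" using v(2)[OF A] by blast
      obtain B where B: "B ** A = mat 1" using S.inverse[OF A] by blast
      have "B *v (A *v v) = v" by (simp add: matrix_vector_mul_assoc B)
      hence "c \<noteq> 0" using v(1) c by auto
      thus ?thesis using c proj_scale by simp
    qed
    hence "{proj (A *v v) | A. A \<in> SU21_preimage G} \<subseteq> {proj v}" by blast
    thus False using inf finite_subset by blast
  qed
  let ?C = "{proj w | w. w \<in> {w. herm w v = 0} \<and> w \<noteq> 0} \<inter> H2C"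
  have C_iff: "proj w \<in> ?C \<longleftrightarrow> herm w v = 0 \<and> Re (herm w w) < 0" for w
  proof
    assume w: "proj w \<in> ?C"
    then obtain w' where w': "proj w = proj w'" "herm w' v = 0" by blast
    then obtain c where "w = c *s w'" by (elim proj_eqE)
    thus "herm w v = 0 \<and> Re (herm w w) < 0"
      using w w' by (simp add: proj_in_H2C_iff herm_scale_left)
  next
    assume "herm w v = 0 \<and> Re (herm w w) < 0"
    moreover from this have "w \<noteq> 0" by auto
    ultimately show "proj w \<in> ?C" by (auto simp: proj_in_H2C_iff)
  qed
  have "leaves_invariant G ?C"
  proof (rule leaves_invariantI[OF sub])
    show "\<exists>v. p = proj v" if "p \<in> ?C" for p using that by blast
    fix A w assume A: "A \<in> SU21_preimage G" and "proj w \<in> ?C"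
    hence w: "herm w v = 0" "Re (herm w w) < 0" by (simp_all only: C_iff)
    obtain B where B: "B \<in> SU21_preimage G" "A ** B = mat 1" using S.inverse[OF A] by blast
    obtain c where c: "B *v v = c *s v" using v(2)[OF B(1)] by blast
    have "herm (A *v w) v = herm (A *v w) (A *v (B *v v))"
      by (simp add: matrix_vector_mul_assoc B)
    also have "\<dots> = herm w (B *v v)" by (rule S.herm_invariant[OF A])
    finally have "herm (A *v w) v = 0" using w by (simp add: c herm_scale_right)
    moreover have "Re (herm (A *v w) (A *v w)) < 0" using w by (simp add: S.herm_invariant[OF A])
    ultimately show "proj (A *v w) \<in> ?C" by (simp only: C_iff)
  qed
  thus ?thesis
    unfolding C_Fuchsian_def using G(1) complex_geodesic_orthogonal[OF pos] by blast
qed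

text \<open>The unitary matrix \<open>M\<close> intertwines \<open>vconj\<close> with
  \<open>j\<close>, so it maps the real vectors bijectively onto the vectors fixed by
  \<open>j\<close>.\<close>

lemma (in real_structure) totally_real_plane_of_fixed_points:
  obtains P where "totally_real_plane P"
    "\<And>p. p \<in> P \<longleftrightarrow> (\<exists>x. p = proj x \<and> j x = x \<and> Re (herm x x) < 0)"
proof -
  obtain M where M: "M \<in> carrier U21" "\<And>z. j (M *v z) = M *v vconj z"
    using standard_form by blast
  obtain B where B: "B ** M = mat 1" "M ** B = mat 1" using U21_inverse[OF M(1)] by blast
  define P where "P = act (pu_class M) ` (real_points \<inter> H2C)"
  have real_iff: "(\<forall>i. r $ i \<in> \<real>) \<longleftrightarrow> vconj r = r" for r
    by (simp add: vconj_def vec_eq_iff Reals_cnj_iff)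
  show thesis
  proof (rule that[of P])
    show "totally_real_plane P"
      unfolding totally_real_plane_def P_def carrier_PU21 using M(1) by blast
    fix p
    show "p \<in> P \<longleftrightarrow> (\<exists>x. p = proj x \<and> j x = x \<and> Re (herm x x) < 0)"
    proof
      assume "p \<in> P"
      then obtain r where r: "vconj r = r" "proj r \<in> H2C" "p = act (pu_class M) (proj r)"
        unfolding P_def real_points_def real_iff by blast
      have "p = proj (M *v r)" using r by (simp add: act_pu_class)
      moreover have "j (M *v r) = M *v r" using M(2) r by simp
      moreover have "Re (herm (M *v r) (M *v r)) < 0"
        using r by (simp add: U21_herm[OF M(1)] proj_in_H2C_iff)
      ultimately show "\<exists>x. p = proj x \<and> j x = x \<and> Re (herm x x) < 0" by blast
    next
      assume "\<exists>x. p = proj x \<and> j x = x \<and> Re (herm x x) < 0"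
      then obtain x where x: "p = proj x" "j x = x" "Re (herm x x) < 0" by blast
      define r where "r = B *v x"
      have Mr: "M *v r = x" by (simp add: r_def matrix_vector_mul_assoc B)
      have "M *v vconj r = M *v r" using M(2)[of r] Mr x by simp
      hence "B *v (M *v vconj r) = B *v (M *v r)" by simp
      hence "vconj r = r" by (simp add: matrix_vector_mul_assoc B)
      moreover have neg: "Re (herm r r) < 0" using x U21_herm[OF M(1), of r r] Mr by simp
      moreover from neg have "r \<noteq> 0" by auto
      ultimately have "proj r \<in> real_points \<inter> H2C"
        unfolding real_points_def real_iff by (auto simp: proj_in_H2C_iff)
      moreover have "act (pu_class M) (proj r) = p" by (simp add: act_pu_class Mr x)
      ultimately show "p \<in> P" unfolding P_def by blast
    qed
  qed
qed

text \<open>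
  Conjugating \<open>j\<close> by an element of \<open>S\<close> gives another map of this kind commuting with
  the normal subgroup \<open>N\<close>; by Schur's lemma both differ by a unit scalar \<open>c\<close>, and
  multiplying with a square root of \<open>c\<close> maps fixed vectors to fixed vectors.
\<close>

lemma (in normal_pair) fixed_vectors_permuted:
  assumes irr: "acts_irreducibly N" and "antilinear_map j"
    and comm: "\<And>n v. n \<in> N \<Longrightarrow> j (n *v v) = n *v j v" and inv: "\<And>v. j (j v) = v"
    and A: "A \<in> S" and x: "j x = x" "x \<noteq> 0"
  obtains d where "d \<noteq> 0" "j (d *s (A *v x)) = d *s (A *v x)"
proof -
  interpret antilinear_map j by fact
  obtain B where B: "B \<in> S" "A ** B = mat 1" "B ** A = mat 1" using inverse[OF A] by blast
  \<comment> \<open>Two occurrences of \<open>j\<close> make the map linear, and normality of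
    \<open>N\<close> makes it commute with \<open>N\<close>.\<close>
  have "\<exists>c. \<forall>v. B *v j (A *v j v) = c *s v"
  proof (rule sub.commuting_map_is_scalar[OF sub.burnside[OF irr]])
    fix n v assume n: "n \<in> N"
    have n': "A ** n ** B \<in> N" by (rule normal[OF A B(1,2) n])
    have "A *v j (n *v v) = (A ** n ** B) *v (A *v j v)"
      using B(3) by (simp add: comm[OF n] mult_vec_cancel flip: matrix_vector_mul_assoc)
    hence "j (A *v j (n *v v)) = (A ** n ** B) *v j (A *v j v)" using comm[OF n'] by simp
    thus "B *v j (A *v j (n *v v)) = n *v (B *v j (A *v j v))"
      using B(3) by (simp add: mult_vec_cancel flip: matrix_vector_mul_assoc)
  qed (simp_all add: j_add j_scale matrix_vector_right_distrib vec.scale)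
  then obtain c where c: "\<And>v. B *v j (A *v j v) = c *s v" by blast
  have "A *v (B *v j (A *v x)) = A *v (c *s x)" using c[of x] x by simp
  hence jA: "j (A *v x) = c *s (A *v x)" by (simp add: mult_vec_cancel[OF B(2)] vec.scale)
  have "A *v x \<noteq> 0" using mult_vec_cancel[OF B(3), of x] x by auto
  moreover have "(cnj c * c) *s (A *v x) = A *v x"
    using inv[of "A *v x"] by (simp add: jA j_scale)
  ultimately have "cnj c * c = 1"
    by (metis vec.scale_cancel_right vec.scale_one)
  \<comment> \<open>As \<open>d * d = c\<close> and \<open>d\<close> has modulus 1, the factor
    \<open>cnj d * c\<close> produced by \<open>j\<close> equals \<open>d\<close>.\<close>
  define d where "d = csqrt c"
  have d2: "d * d = c" by (simp add: d_def flip: power2_eq_square)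
  have "(cmod d)\<^sup>2 = 1"
  proof -
    have "of_real ((cmod c)\<^sup>2) = (1 :: complex)"
      unfolding complex_norm_square using \<open>cnj c * c = 1\<close> by (simp add: mult.commute)
    hence "(cmod c)\<^sup>2 = 1" by (simp only: of_real_eq_1_iff)
    hence "cmod c = 1" using power2_eq_imp_eq[of "cmod c" 1] by simp
    thus ?thesis by (simp add: d2[symmetric] norm_mult power2_eq_square)
  qed
  hence "d * cnj d = 1" by (metis complex_norm_square of_real_1)
  hence "cnj d * c = d" by (simp add: d2[symmetric] mult.commute flip: mult.assoc)
  hence "j (d *s (A *v x)) = d *s (A *v x)" by (simp add: j_scale jA)
  moreover have "d \<noteq> 0" using \<open>d * cnj d = 1\<close> by auto
  ultimately show thesis using that by blast
qed

lemma R_Fuchsian_of_irreducible: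
  assumes G: "discrete_subgroup G" and real: "invariant_trace_field G \<subseteq> \<real>"
    and irr: "acts_irreducibly (cube_subgroup (SU21_preimage G))"
  shows "R_Fuchsian G"
proof -
  have sub: "subgroup G PU21" using G by (simp add: discrete_subgroup_def)
  interpret normal_pair "SU21_preimage G" "cube_subgroup (SU21_preimage G)"
    by (rule normal_pair_cubes[OF sub])
  obtain j where j: "antilinear_map j"
    "\<And>n v. n \<in> cube_subgroup (SU21_preimage G) \<Longrightarrow> j (n *v v) = n *v j v" "\<And>v. j (j v) = v"
    using sub.invariant_antilinear_map[OF irr cube_traces_real[OF sub real]] by blast
  interpret j: real_structure j
    by (intro real_structure.intro real_structure_axioms.intro j
        sub.form_conjugate[OF irr j])
  obtain P where P: "totally_real_plane P"
    "\<And>p. p \<in> P \<longleftrightarrow> (\<exists>x. p = proj x \<and> j x = x \<and> Re (herm x x) < 0)"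
    by (rule j.totally_real_plane_of_fixed_points) blast
  have "leaves_invariant G P"
  proof (rule leaves_invariantI[OF sub])
    show "\<exists>v. p = proj v" if "p \<in> P" for p using that P(2) by blast
    fix A v assume A: "A \<in> SU21_preimage G" and "proj v \<in> P"
    then obtain x where x: "proj v = proj x" "j x = x" "Re (herm x x) < 0" using P(2) by blast
    hence "x \<noteq> 0" by auto
    then obtain d where d: "d \<noteq> 0" "j (d *s (A *v x)) = d *s (A *v x)"
      using fixed_vectors_permuted[OF irr j A x(2)] by blast
    obtain c where c: "c \<noteq> 0" "v = c *s x" using x(1) by (rule proj_eqE)
    have "proj (A *v v) = proj (A *v x)" using c by (simp add: vec.scale proj_scale)
    also have "\<dots> = proj (d *s (A *v x))" using d by (simp add: proj_scale)
    finally have eq: "proj (A *v v) = proj (d *s (A *v x))" .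
    have "proj (A *v x) \<in> H2C" using x by (simp add: proj_in_H2C_iff herm_invariant[OF A])
    hence "proj (d *s (A *v x)) \<in> H2C" using d by (simp add: proj_scale)
    thus "proj (A *v v) \<in> P" unfolding eq P(2) using d(2) by (auto simp: proj_in_H2C_iff)
  qed
  thus ?thesis unfolding R_Fuchsian_def using G P(1) by blast
qed

lemma cubes_irreducible:
  assumes G: "subgroup G PU21" "\<not> elementary G" and real: "invariant_trace_field G \<subseteq> \<real>"
    and irr: "acts_irreducibly (SU21_preimage G)"
  shows "acts_irreducibly (cube_subgroup (SU21_preimage G))"
proof (rule ccontr)
  assume red: "\<not> ?thesis"
  interpret normal_pair "SU21_preimage G" "cube_subgroup (SU21_preimage G)"
    by (rule normal_pair_cubes[OF G(1)])
  have trivial: "n = mat 1" if n: "n \<in> cube_subgroup (SU21_preimage G)" for n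
  proof -
    obtain c where c: "n = mat c"
      by (rule reducible_normal_subgroup_scalar[OF irr red orbit_infinite[OF G] n])
    \<comment> \<open>The trace makes the scalar real, and a real scalar whose cube is 1 equals
      1.\<close>
    have "trace n = 3 * c" by (simp add: c trace_def mat_def)
    hence "3 * c \<in> \<real>" using cube_traces_real[OF G(1) real n] by simp
    hence "c \<in> \<real>" by (metis Reals_divide Reals_numeral nonzero_mult_div_cancel_left zero_neq_numeral)
    then obtain r where r: "c = of_real r" by (metis Reals_cases)
    have "n \<in> carrier SU21" using n cubes_subset[OF G(1)] by (auto simp: SU21_preimage_def)
    hence "c ^ 3 = 1" by (simp add: SU21_def c det_3 mat_def power3_eq_cube)
    hence "r ^ 3 = 1" unfolding r of_real_power[symmetric] by (simp only: of_real_eq_1_iff)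
    moreover from this have "r \<ge> 0" using zero_le_odd_power[of 3 r] by simp
    ultimately have "r = 1" using power_eq_imp_eq_base[of r 3 1] by simp
    thus ?thesis using c r by simp
  qed
  have "finite (SU21_preimage G)"
  proof (rule finite_of_exponent_three[OF irr])
    fix A assume A: "A \<in> SU21_preimage G"
    hence "A [^]\<^bsub>SU21\<^esub> (3::nat) \<in> cube_subgroup (SU21_preimage G)"
      unfolding cube_subgroup_def by (blast intro: generate.incl)
    thus "A ** A ** A = mat 1" using trivial by (simp add: cube_SU21)
    show "det A = 1" using A by (simp add: SU21_preimage_def SU21_def)
  qed
  \<comment> \<open>The first basis vector is isotropic, so a finite group would give a boundary
    point with finite orbit.\<close>
  hence "finite {proj (A *v axis 1 1) | A. A \<in> SU21_preimage G}" by simp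
  moreover have "herm (axis 1 1) (axis 1 1) = 0"
    unfolding herm_axis by (simp add: axis_def)
  moreover have "axis 1 1 \<noteq> (0 :: complex^3)" by simp
  ultimately show False using orbit_infinite[OF G, of "axis 1 1"] by simp
qed

theorem theoremD:
  fixes G :: "(complex^3^3) set set"
  assumes "discrete_subgroup G"
    and "\<not> elementary G"
    and "invariant_trace_field G \<subseteq> \<real>"
  shows "R_Fuchsian G \<or> C_Fuchsian G"
proof (cases "acts_irreducibly (SU21_preimage G)")
  case True
  have "subgroup G PU21" using assms(1) by (simp add: discrete_subgroup_def)
  hence "acts_irreducibly (cube_subgroup (SU21_preimage G))"
    using cubes_irreducible assms True by blast
  thus ?thesis using R_Fuchsian_of_irreducible assms by blast
next
  case False
  thus ?thesis using C_Fuchsian_of_reducible assms by blast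
qed

end
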